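(* Let $2\leq a_1\leq\dots\leq a_{d-1}$ be integers. The Turan algebra $TA(a_1,\dots,a_{d-1})$ is presented by quadrics. Its Hilbert vector $(h_0,h_1,\dots,h_d)$ is given by $h_k=s_k+s_{d-k}$, where $s_k=s_k(a_1,\dots,a_{d-1})$ is the elementary symmetric polynomial of order $k$ evaluated at $(a_1,\dots,a_{d-1})$.
   Context: $\mathbb{K}$ is a field of characteristic $0$. A simplicial complex on a finite vertex set is a collection of subsets (faces) closed under taking subsets; facets are the maximal faces; it is homogeneous of dimension $d-2$ if all facets have $d-1$ elements. Turan complex: for integers $2\le a_1\le\dots\le a_{d-1}$, the Turan complex $\mathcal{TK}(a_1,\dots,a_{d-1})$ is the homogeneous simplicial complex of dimension $d-2$ whose set of facets is the cartesian product $\prod_{i=1}^{d-1}\{1,2,\dots,a_i\}$, where the sets $\{1,\dots,a_i\}$ for different $i$ are regarded as disjoint sets of vertices. That is, the vertex set is the disjoint union of $d-1$ sets of cardinalities $a_1,\dots,a_{d-1}$, and a facet consists of exactly one vertex from each of these sets. Associated algebra: let $\Delta$ be a homogeneous simplicial complex of dimension $d-2$ with vertices $u_1,\dots,u_m$, and let $g_1,\dots,g_n\in\mathbb{K}[u_1,\dots,u_m]_{d-1}$ be the square-free monomials $\prod_{u_j\in F}u_j$ of its facets $F$. Put $f_\Delta=\sum_{i=1}^n x_ig_i\in R=\mathbb{K}[x_1,\dots,x_n,u_1,\dots,u_m]$. Let $Q=\mathbb{K}[X_1,\dots,X_n,U_1,\dots,U_m]$ act on $R$ by $X_i=\partial/\partial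 x_i$, $U_j=\partial/\partial u_j$, and let $\operatorname{Ann}_Q(f)=\{p\in Q: p(f)=0\}$. The associated algebra is $A_\Delta=Q/\operatorname{Ann}_Q(f_\Delta)$, a standard graded Artinian Gorenstein algebra of socle degree $d$. The Turan algebra $TA(a_1,\dots,a_{d-1})$ is the algebra associated to $\Delta=\mathcal{TK}(a_1,\dots,a_{d-1})$. A standard graded $\mathbb{K}$-algebra is presented by quadrics if it is isomorphic to a quotient of a polynomial ring over $\mathbb{K}$ by a homogeneous ideal having a set of generators consisting of quadratic forms. The Hilbert vector of $A=\bigoplus_{k=0}^d A_k$ is $(h_0,\dots,h_d)$ with $h_k=\dim_{\mathbb{K}}A_k$. Conventions: $s_0=1$ and $s_k=0$ for $k\geq d$. *)

theory Defs
  imports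
    "HOL-Library.Poly_Mapping"
    "HOL-Library.FuncSet"
    "HOL-Algebra.Module"
    "HOL-Algebra.QuotRing"
    "HOL-Algebra.Embedded_Algebras"
begin

section \<open>Polynomial rings in finitely many variables\<close>

text \<open>
  A polynomial is a finitely supported family of coefficients, indexed by monomials; a monomial
  is a finitely supported family of exponents. The variable type \<open>'x\<close> may be infinite or contain
  superfluous elements, so the ring \<open>K[V]\<close> is carved out by a set \<open>V\<close> of variables.
\<close>

type_synonym ('x, 'k) mpoly = "('x \<Rightarrow>\<^sub>0 nat) \<Rightarrow>\<^sub>0 'k"

definition mp_const :: "'k::field \<Rightarrow> ('x, 'k) mpoly" where
  "mp_const c = Poly_Mapping.single 0 c"

definition mp_var :: "'x \<Rightarrow> ('x, 'k::field) mpoly" where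
  "mp_var v = Poly_Mapping.single (Poly_Mapping.single v 1) 1"

definition poly_ring :: "'x set \<Rightarrow> ('x, 'k::field) mpoly ring" where
  "poly_ring V =
     \<lparr>carrier = {p. \<forall>m \<in> Poly_Mapping.keys p. Poly_Mapping.keys m \<subseteq> V},
      mult = (*), one = 1, zero = 0, add = (+)\<rparr>"

definition mono_degree :: "('x \<Rightarrow>\<^sub>0 nat) \<Rightarrow> nat" where
  "mono_degree m = (\<Sum>v \<in> Poly_Mapping.keys m. Poly_Mapping.lookup m v)"

definition forms :: "'x set \<Rightarrow> nat \<Rightarrow> ('x, 'k::field) mpoly set" where
  "forms V k = {p \<in> carrier (poly_ring V). \<forall>m \<in> Poly_Mapping.keys p. mono_degree m = k}"

section \<open>Action by differentiation\<close>

definition mp_deriv :: "'x \<Rightarrow> ('x, 'k::field) mpoly \<Rightarrow> ('x, 'k) mpoly" where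
  "mp_deriv v p = (\<Sum>m \<in> Poly_Mapping.keys p.
     Poly_Mapping.single (m - Poly_Mapping.single v 1)
       (of_nat (Poly_Mapping.lookup m v) * Poly_Mapping.lookup p m))"

lemma lookup_mp_deriv:
  "Poly_Mapping.lookup (mp_deriv v p) m =
     of_nat (Suc (Poly_Mapping.lookup m v)) * Poly_Mapping.lookup p (m + Poly_Mapping.single v 1)"
proof -
  let ?e = "Poly_Mapping.single v (1::nat)"
  let ?c = "\<lambda>m'. of_nat (Poly_Mapping.lookup m' v) * Poly_Mapping.lookup p m'"
  have *: "(?c m' when m' - ?e = m) = (if m' = m + ?e then ?c m' else 0)" for m'
  proof (cases "Poly_Mapping.lookup m' v = 0")
    case True
    then have "m' \<noteq> m + ?e" by (auto simp: lookup_add)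
    with True show ?thesis by simp
  next
    case False
    then have "m' - ?e + ?e = m'"
      by (intro poly_mapping_eqI) (auto simp: lookup_add lookup_minus lookup_single when_def)
    then have "m' - ?e = m \<longleftrightarrow> m' = m + ?e" by (metis add_diff_cancel_right')
    then show ?thesis by (simp only: when_def)
  qed
  have "Poly_Mapping.lookup (mp_deriv v p) m =
      (\<Sum>m' \<in> Poly_Mapping.keys p. if m' = m + ?e then ?c m' else 0)"
    by (simp only: mp_deriv_def lookup_sum lookup_single *)
  also have "\<dots> = ?c (m + ?e)"
    by (simp add: sum.delta in_keys_iff)
  finally show ?thesis by (simp add: lookup_add)
qed

lemma mp_deriv_commute: "mp_deriv v (mp_deriv w p) = mp_deriv w (mp_deriv v p)"
proof (cases "v = w")
  case False
  show ?thesis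
  proof (rule poly_mapping_eqI)
    fix m
    have "m + Poly_Mapping.single v 1 + Poly_Mapping.single w 1 =
        m + Poly_Mapping.single w 1 + Poly_Mapping.single v (1::nat)"
      by (simp only: add_ac)
    then show "Poly_Mapping.lookup (mp_deriv v (mp_deriv w p)) m =
        Poly_Mapping.lookup (mp_deriv w (mp_deriv v p)) m"
      using False False[symmetric]
      by (simp only: lookup_mp_deriv lookup_add lookup_single when_def if_False
          add_0_right mult.left_commute)
  qed
qed simp

text \<open>
  The differential operator \<open>\<Prod>v. (\<partial>/\<partial>v)^(m v)\<close> attached to a monomial \<open>m\<close>; the order in which
  the fold composes the derivatives is irrelevant by the commutation lemma above.
\<close>

definition mono_act :: "('x \<Rightarrow>\<^sub>0 nat) \<Rightarrow> ('x, 'k::field) mpoly \<Rightarrow> ('x, 'k) mpoly" where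
  "mono_act m f =
     Finite_Set.fold (\<lambda>v. mp_deriv v ^^ Poly_Mapping.lookup m v) f (Poly_Mapping.keys m)"

text \<open>
  \<open>mp_act p f\<close> is \<open>p(f)\<close>: capital and small letters are identified, i.e. the variable \<open>v\<close> of the
  operator \<open>p\<close> acts on \<open>f\<close> as \<open>\<partial>/\<partial>v\<close>.
\<close>

definition mp_act :: "('x, 'k::field) mpoly \<Rightarrow> ('x, 'k) mpoly \<Rightarrow> ('x, 'k) mpoly" where
  "mp_act p f =
     (\<Sum>m \<in> Poly_Mapping.keys p. mp_const (Poly_Mapping.lookup p m) * mono_act m f)"

definition Ann :: "'x set \<Rightarrow> ('x, 'k::field) mpoly \<Rightarrow> ('x, 'k) mpoly set" where
  "Ann V f = {p \<in> carrier (poly_ring V). mp_act p f = 0}"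

section \<open>Graded algebras\<close>

record ('k, 'a) graded_algebra = "('k, 'a) module" +
  grade :: "nat \<Rightarrow> 'a set"

text \<open>The quotient \<open>K[V] / I\<close>, graded by the images of the spaces of forms.\<close>

definition quotient_algebra ::
    "'x set \<Rightarrow> ('x, 'k::field) mpoly set \<Rightarrow> ('k, ('x, 'k) mpoly set) graded_algebra" where
  "quotient_algebra V I = (let A = poly_ring V Quot I in
     \<lparr>carrier = carrier A, mult = mult A, one = one A, zero = zero A, add = add A,
      smult = (\<lambda>c x. (I +>\<^bsub>poly_ring V\<^esub> mp_const c) \<otimes>\<^bsub>A\<^esub> x),
      grade = (\<lambda>k. (\<lambda>p. I +>\<^bsub>poly_ring V\<^esub> p) ` forms V k)\<rparr>)"

definition graded_iso ::
    "('k, 'a) graded_algebra \<Rightarrow> ('k, 'b) graded_algebra \<Rightarrow> ('a \<Rightarrow> 'b) set" where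
  "graded_iso A B = {h \<in> ring_iso A B.
     (\<forall>c. \<forall>x \<in> carrier A. h (c \<odot>\<^bsub>A\<^esub> x) = c \<odot>\<^bsub>B\<^esub> h x) \<and>
     (\<forall>k. h ` grade A k = grade B k)}"

text \<open>
  Polynomial rings in finitely many variables are represented by \<open>K[y_0, ..., y_(N-1)]\<close>, with the
  natural numbers below \<open>N\<close> as names of variables. The zero form is allowed in \<open>S\<close>.
\<close>

definition presented_by_quadrics :: "('k::field, 'a) graded_algebra \<Rightarrow> bool" where
  "presented_by_quadrics A \<longleftrightarrow>
     (\<exists>N::nat. \<exists>S \<subseteq> forms {..<N} 2.
        graded_iso A (quotient_algebra {..<N} (Idl\<^bsub>poly_ring {..<N}\<^esub> S)) \<noteq> {})"

text \<open>
  The copy of the ground field inside the algebra, over which \<^const>\<open>ring.dimension\<close> measures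
  subspaces.
\<close>

definition base_field :: "('k, 'a) graded_algebra \<Rightarrow> 'a set" where
  "base_field A = range (\<lambda>c. c \<odot>\<^bsub>A\<^esub> \<one>\<^bsub>A\<^esub>)"

text \<open>
  The list \<open>[h_0, ..., h_d]\<close> is the Hilbert vector if \<open>h_k\<close> is the dimension of the degree \<open>k\<close> part
  and there is nothing in degrees beyond \<open>d\<close>.
\<close>

definition hilbert_vector :: "('k, 'a) graded_algebra \<Rightarrow> nat list \<Rightarrow> bool" where
  "hilbert_vector A h \<longleftrightarrow>
     (\<forall>k < length h. ring.dimension A (h ! k) (base_field A) (grade A k)) \<and>
     (\<forall>k \<ge> length h. grade A k = {\<zero>\<^bsub>A\<^esub>})"

section \<open>Simplicial complexes and their associated algebras\<close>

definition simplicial_complex :: "'v set \<Rightarrow> 'v set set \<Rightarrow> bool" where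
  "simplicial_complex V \<Delta> \<longleftrightarrow>
     finite V \<and> \<Delta> \<subseteq> Pow V \<and> (\<forall>F \<in> \<Delta>. \<forall>G. G \<subseteq> F \<longrightarrow> G \<in> \<Delta>)"

definition facets :: "'v set set \<Rightarrow> 'v set set" where
  "facets \<Delta> = {F \<in> \<Delta>. \<forall>G \<in> \<Delta>. F \<subseteq> G \<longrightarrow> G = F}"

text \<open>There is one variable \<open>FacetVar F\<close> for every facet \<open>F\<close> and one variable
  \<open>VertexVar v\<close> for every vertex \<open>v\<close>.\<close>

datatype 'v cvar = FacetVar "'v set" | VertexVar 'v

definition cvars :: "'v set \<Rightarrow> 'v set set \<Rightarrow> 'v cvar set" where
  "cvars V \<Delta> = FacetVar ` facets \<Delta> \<union> VertexVar ` V"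

definition complex_form :: "'v set set \<Rightarrow> ('v cvar, 'k::field) mpoly" where
  "complex_form \<Delta> = (\<Sum>F \<in> facets \<Delta>. mp_var (FacetVar F) * (\<Prod>v \<in> F. mp_var (VertexVar v)))"

definition associated_algebra ::
    "'v set \<Rightarrow> 'v set set \<Rightarrow> ('k::field, ('v cvar, 'k) mpoly set) graded_algebra" where
  "associated_algebra V \<Delta> =
     quotient_algebra (cvars V \<Delta>) (Ann (cvars V \<Delta>) (complex_form \<Delta>))"

section \<open>The Turan complex and the Turan algebra\<close>

text \<open>
  The pair \<open>(i, j)\<close> is the vertex \<open>j\<close> of the \<open>i\<close>-th set \<open>{1, ..., a i}\<close>, where \<open>i = 1, ..., d - 1\<close>;
  tagging with \<open>i\<close> makes these sets disjoint. An element \<open>c\<close> of their cartesian product is the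
  facet \<open>{(1, c 1), ..., (d - 1, c (d - 1))}\<close>.
\<close>

definition turan_vertices :: "nat \<Rightarrow> (nat \<Rightarrow> nat) \<Rightarrow> (nat \<times> nat) set" where
  "turan_vertices d a = (SIGMA i:{1..<d}. {1..a i})"

definition turan_facets :: "nat \<Rightarrow> (nat \<Rightarrow> nat) \<Rightarrow> (nat \<times> nat) set set" where
  "turan_facets d a =
     (\<lambda>c. (\<lambda>i. (i, c i)) ` {1..<d}) ` (\<Pi>\<^sub>E i \<in> {1..<d}. {1..a i})"

definition turan_complex :: "nat \<Rightarrow> (nat \<Rightarrow> nat) \<Rightarrow> (nat \<times> nat) set set" where
  "turan_complex d a = (\<Union>F \<in> turan_facets d a. Pow F)"

lemma card_turan_facet:
  assumes "F \<in> turan_facets d a"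
  shows "finite F" "card F = d - 1"
  using assms by (auto simp: turan_facets_def card_image inj_on_def)

lemma simplicial_complex_turan: "simplicial_complex (turan_vertices d a) (turan_complex d a)"
  unfolding simplicial_complex_def
proof (intro conjI)
  show "finite (turan_vertices d a)" by (simp add: turan_vertices_def)
  show "turan_complex d a \<subseteq> Pow (turan_vertices d a)"
    by (fastforce simp: turan_complex_def turan_facets_def turan_vertices_def PiE_iff)
  show "\<forall>F \<in> turan_complex d a. \<forall>G. G \<subseteq> F \<longrightarrow> G \<in> turan_complex d a"
    by (auto simp: turan_complex_def)
qed

lemma facets_turan_complex: "facets (turan_complex d a) = turan_facets d a"
proof (intro equalityI subsetI)
  fix F assume "F \<in> facets (turan_complex d a)"
  then show "F \<in> turan_facets d a"
    by (auto simp: facets_def turan_complex_def)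
next
  fix F assume F: "F \<in> turan_facets d a"
  have "G = F" if "G \<in> turan_complex d a" "F \<subseteq> G" for G
  proof -
    from that(1) obtain H where H: "H \<in> turan_facets d a" "G \<subseteq> H"
      by (auto simp: turan_complex_def)
    have "F = H"
      using card_turan_facet[OF F] card_turan_facet[OF H(1)] H(2) that(2)
      by (metis card_subset_eq subset_trans)
    with H(2) that(2) show ?thesis by auto
  qed
  with F show "F \<in> facets (turan_complex d a)"
    by (auto simp: facets_def turan_complex_def)
qed

type_synonym 'k turan_algebra = "('k, ((nat \<times> nat) cvar, 'k) mpoly set) graded_algebra"

definition turan_algebra :: "nat \<Rightarrow> (nat \<Rightarrow> nat) \<Rightarrow> 'k::field turan_algebra" where
  "turan_algebra d a = associated_algebra (turan_vertices d a) (turan_complex d a)"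

text \<open>The elementary symmetric polynomial of order \<open>k\<close> in \<open>a 1, ..., a (d - 1)\<close>.\<close>

definition elem_sym :: "nat \<Rightarrow> (nat \<Rightarrow> nat) \<Rightarrow> nat \<Rightarrow> nat" where
  "elem_sym d a k = (\<Sum>S | S \<subseteq> {1..<d} \<and> card S = k. \<Prod>i \<in> S. a i)"

lemma elem_sym_0: "elem_sym d a 0 = 1"
proof -
  have "{S. S \<subseteq> {1..<d} \<and> card S = 0} = {{}}"
    using finite_subset[of _ "{1..<d}"] by auto
  then show ?thesis by (simp add: elem_sym_def)
qed

lemma elem_sym_ge:
  assumes "1 \<le> d" "d \<le> k"
  shows "elem_sym d a k = 0"
proof -
  have "card S < k" if "S \<subseteq> {1..<d}" for S
    using card_mono[OF _ that] assms by simp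
  then have "{S. S \<subseteq> {1..<d} \<and> card S = k} = {}"
    by blast
  then show ?thesis by (simp only: elem_sym_def sum.empty)
qed

end

theory Submission
  imports Defs
begin

text \<open>
  Write \<open>X_F\<close> for the facet variables and \<open>U_S\<close> for the product of the vertex variables of \<open>S\<close>. The
  form is annihilated by \<open>X_F X_G\<close>, by \<open>U_v U_w\<close> with \<open>v\<close>, \<open>w\<close> in the same class, by \<open>X_F U_v\<close> with
  \<open>v\<close> not in \<open>F\<close>, and by \<open>X_F U_v - X_G U_w\<close> with \<open>F - {v} = G - {w}\<close>. Modulo these quadrics every
  monomial is zero or equal to some \<open>U_S\<close> with \<open>S\<close> a face, or to some \<open>X_F U_(F - T)\<close> with \<open>T\<close> a face
  of \<open>F\<close>; the latter only depends on \<open>T\<close>, since any two facets containing \<open>T\<close> are connected by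
  exchanging one vertex at a time. As \<open>U_S X_F U_(F - T)\<close> sends the form to \<open>1\<close> if \<open>S = T\<close> and to \<open>0\<close>
  otherwise, while all other products of two normal forms send it to a form without constant term,
  these monomials are independent modulo the annihilator. So the quadrics generate the annihilator,
  and the faces with \<open>k\<close> and with \<open>d - k\<close> vertices index a basis of the part of degree \<open>k\<close>.
\<close>

section \<open>Polynomials\<close>

text \<open>A finitely supported function is the sum of its single terms. The bound \<open>X\<close>
  on the support is carried through the induction, so that restrictions on the variables or the
  degree of the monomials remain available in every case.\<close>

lemma poly_mapping_single_induct [consumes 1, case_names zero single add]:
  assumes "Poly_Mapping.keys p \<subseteq> X"
    and "P 0"
    and "\<And>m c. m \<in> X \<Longrightarrow> P (Poly_Mapping.single m c)"
    and "\<And>p q. Poly_Mapping.keys p \<subseteq> X \<Longrightarrow> Poly_Mapping.keys q \<subseteq> X \<Longrightarrow> P p \<Longrightarrow> P q \<Longrightarrow> P (p + q)"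
  shows "P (p :: 'a \<Rightarrow>\<^sub>0 'b::comm_monoid_add)"
proof -
  let ?s = "\<lambda>M. \<Sum>m\<in>M. Poly_Mapping.single m (Poly_Mapping.lookup p m)"
  have "p = ?s (Poly_Mapping.keys p)"
    by (rule poly_mapping_eqI)
      (auto simp: lookup_sum lookup_single when_def in_keys_iff sum.delta)
  moreover have "Poly_Mapping.keys (?s M) \<subseteq> X \<and> P (?s M)" if "finite M" "M \<subseteq> X" for M
    using that
  proof (induction M rule: finite_induct)
    case (insert m M)
    let ?t = "Poly_Mapping.single m (Poly_Mapping.lookup p m)"
    have "Poly_Mapping.keys ?t \<subseteq> X" "P ?t"
      using insert.prems by (auto intro: assms(3))
    moreover from insert have "Poly_Mapping.keys (?s M) \<subseteq> X" "P (?s M)"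
      by auto
    ultimately have "Poly_Mapping.keys (?t + ?s M) \<subseteq> X" "P (?t + ?s M)"
      using keys_add[of ?t "?s M"] assms(4) by blast+
    then show ?case
      by (simp only: sum.insert[OF insert.hyps])
  qed (use assms(2) in simp)
  ultimately show ?thesis
    using assms(1) by (metis finite_keys)
qed

text \<open>The additive extension of a map given on single terms. Suitable choices of
  \<open>h\<close> yield the pairing of a functional with a polynomial and the renaming of variables
  in monomials and polynomials.\<close>

definition extend :: "('a \<Rightarrow> 'b::zero \<Rightarrow> 'c::comm_monoid_add) \<Rightarrow> ('a \<Rightarrow>\<^sub>0 'b) \<Rightarrow> 'c" where
  "extend h p = (\<Sum>m \<in> Poly_Mapping.keys p. h m (Poly_Mapping.lookup p m))"

lemma extend_superset:
  assumes "finite M" "Poly_Mapping.keys p \<subseteq> M" "\<And>m. h m 0 = 0"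
  shows "extend h p = (\<Sum>m \<in> M. h m (Poly_Mapping.lookup p m))"
  unfolding extend_def using assms
  by (intro sum.mono_neutral_left) (auto simp: in_keys_iff)

lemma extend_0 [simp]: "extend h 0 = 0"
  by (simp add: extend_def)

lemma extend_single:
  assumes "\<And>m. h m 0 = 0"
  shows "extend h (Poly_Mapping.single m c) = h m c"
  by (subst extend_superset[of "{m}"]) (auto simp: assms)

lemma extend_add:
  fixes p q :: "'a \<Rightarrow>\<^sub>0 'b::comm_monoid_add"
  assumes "\<And>m. h m 0 = 0" "\<And>m c c'. h m (c + c') = h m c + h m c'"
  shows "extend h (p + q) = extend h p + extend h q"
proof -
  let ?M = "Poly_Mapping.keys p \<union> Poly_Mapping.keys q"
  have "extend h r = (\<Sum>m \<in> ?M. h m (Poly_Mapping.lookup r m))"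
    if "Poly_Mapping.keys r \<subseteq> ?M" for r
    using that by (intro extend_superset) (auto simp: assms)
  then show ?thesis
    by (simp add: keys_add assms lookup_add sum.distrib)
qed

text \<open>Both sides are additive in \<open>p\<close> and in \<open>q\<close>, so products of two
  single terms suffice.\<close>

lemma extend_mult:
  fixes p q :: "'a::monoid_add \<Rightarrow>\<^sub>0 'b::semiring_0"
    and h :: "'a \<Rightarrow> 'b \<Rightarrow> 'c::semiring_0"
  assumes "\<And>m. h m 0 = 0" "\<And>m c c'. h m (c + c') = h m c + h m c'"
    and "\<And>m m' c c'. h (m + m') (c * c') = h m c * h m' c'"
  shows "extend h (p * q) = extend h p * extend h q"
proof (induction p rule: poly_mapping_single_induct[OF subset_UNIV])
  case (2 m c)
  show ?case
    by (induction q rule: poly_mapping_single_induct[OF subset_UNIV])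
      (simp_all add: assms extend_single extend_add mult_single distrib_left)
qed (simp_all add: extend_add assms distrib_right)

lemma lookup_const_mult:
  "Poly_Mapping.lookup (mp_const c * p) m = c * Poly_Mapping.lookup p m"
  by (simp add: mp_const_def Poly_Mapping.map.rep_eq when_def flip: mult_map_scale_conv_mult)

section \<open>The polynomial ring as a commutative ring, and its ideals\<close>

lemma carrier_poly_ring:
  "carrier (poly_ring V) = {p. Poly_Mapping.keys p \<subseteq> {m. Poly_Mapping.keys m \<subseteq> V}}"
  by (auto simp: poly_ring_def)

lemma poly_ring_sel [simp]:
  "mult (poly_ring V) = (*)" "one (poly_ring V) = 1" "zero (poly_ring V) = 0"
  "add (poly_ring V) = (+)"
  by (simp_all add: poly_ring_def)

lemma poly_ring_single:
  "Poly_Mapping.keys m \<subseteq> V \<Longrightarrow> Poly_Mapping.single m c \<in> carrier (poly_ring V)"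
  by (auto simp: carrier_poly_ring)

lemma poly_ring_const [simp]: "mp_const c \<in> carrier (poly_ring V)"
  by (auto simp: mp_const_def intro: poly_ring_single)

lemma poly_ring_zero [simp]: "0 \<in> carrier (poly_ring V)"
  by (simp add: carrier_poly_ring)

lemma poly_ring_one [simp]: "1 \<in> carrier (poly_ring V)"
  by (auto simp: carrier_poly_ring)

lemma poly_ring_add:
  "p \<in> carrier (poly_ring V) \<Longrightarrow> q \<in> carrier (poly_ring V) \<Longrightarrow> p + q \<in> carrier (poly_ring V)"
  unfolding carrier_poly_ring using keys_add[of p q] by blast

lemma poly_ring_uminus:
  "p \<in> carrier (poly_ring V) \<Longrightarrow> - p \<in> carrier (poly_ring V)"
  by (auto simp: carrier_poly_ring in_keys_iff)

lemma poly_ring_mult: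
  assumes "p \<in> carrier (poly_ring V)" "q \<in> carrier (poly_ring V)"
  shows "p * q \<in> carrier (poly_ring V)"
proof -
  have "Poly_Mapping.keys m \<subseteq> V" if m: "m \<in> Poly_Mapping.keys (p * q)" for m
  proof -
    obtain m1 m2 where "m = m1 + m2" "m1 \<in> Poly_Mapping.keys p" "m2 \<in> Poly_Mapping.keys q"
      using keys_mult[of p q] m by blast
    moreover from this have "Poly_Mapping.keys m1 \<subseteq> V" "Poly_Mapping.keys m2 \<subseteq> V"
      using assms by (auto simp: carrier_poly_ring)
    ultimately show ?thesis
      using keys_add[of m1 m2] by blast
  qed
  then show ?thesis by (auto simp: carrier_poly_ring)
qed

lemma cring_poly_ring: "cring (poly_ring V :: ('x, 'k::field) mpoly ring)"
proof (rule cringI)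
  show "abelian_group (poly_ring V :: ('x, 'k) mpoly ring)"
  proof (rule abelian_groupI)
    fix p :: "('x, 'k) mpoly" assume "p \<in> carrier (poly_ring V)"
    then show "\<exists>q\<in>carrier (poly_ring V). q \<oplus>\<^bsub>poly_ring V\<^esub> p = \<zero>\<^bsub>poly_ring V\<^esub>"
      by (intro bexI[of _ "- p"]) (auto simp: poly_ring_uminus)
  qed (auto simp: poly_ring_add add_ac)
  show "Group.comm_monoid (poly_ring V :: ('x, 'k) mpoly ring)"
  proof (rule comm_monoidI)
  qed (auto simp: poly_ring_mult mult_ac)
qed (auto simp: distrib_right)

lemma poly_ring_sum:
  "(\<And>i. i \<in> I \<Longrightarrow> g i \<in> carrier (poly_ring V)) \<Longrightarrow> sum g I \<in> carrier (poly_ring V)"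
  by (induction I rule: infinite_finite_induct) (auto intro: poly_ring_add)

lemma poly_ring_minus:
  "p \<in> carrier (poly_ring V) \<Longrightarrow> q \<in> carrier (poly_ring V) \<Longrightarrow> p - q \<in> carrier (poly_ring V)"
  using poly_ring_add[of p V "- q"] poly_ring_uminus by auto

lemma poly_ring_a_inv:
  assumes "p \<in> carrier (poly_ring V)"
  shows "\<ominus>\<^bsub>poly_ring V\<^esub> p = - p"
proof -
  interpret cring "poly_ring V" by (rule cring_poly_ring)
  show ?thesis
    using minus_equality[of "- p" p] assms by (simp add: poly_ring_uminus)
qed

text \<open>Additive inverses arise from multiplication by \<open>- 1\<close>, and right multiples
  from commutativity.\<close>

lemma ideal_poly_ringI:
  assumes "I \<subseteq> carrier (poly_ring V)" "0 \<in> I" "\<And>p q. p \<in> I \<Longrightarrow> q \<in> I \<Longrightarrow> p + q \<in> I"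
    and mult: "\<And>r p. r \<in> carrier (poly_ring V) \<Longrightarrow> p \<in> I \<Longrightarrow> r * p \<in> I"
  shows "ideal I (poly_ring V)"
proof -
  interpret cring "poly_ring V" by (rule cring_poly_ring)
  have "- 1 * p \<in> I" if "p \<in> I" for p
    by (intro mult poly_ring_uminus poly_ring_one that)
  then have "\<ominus>\<^bsub>poly_ring V\<^esub> p \<in> I" if "p \<in> I" for p
    using assms(1) that by (auto simp: poly_ring_a_inv)
  moreover have "p * r \<in> I" if "r \<in> carrier (poly_ring V)" "p \<in> I" for r p
    using mult[OF that] by (subst mult.commute)
  ultimately show ?thesis
    using assms by (intro idealI ring_axioms add.subgroupI) (auto simp: a_inv_def)
qed

lemma ideal_poly_ringD:
  assumes "ideal I (poly_ring V)"
  shows "I \<subseteq> carrier (poly_ring V)" "0 \<in> I" "p \<in> I \<Longrightarrow> q \<in> I \<Longrightarrow> p + q \<in> I"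
    "r \<in> carrier (poly_ring V) \<Longrightarrow> p \<in> I \<Longrightarrow> r * p \<in> I"
    "p \<in> I \<Longrightarrow> q \<in> I \<Longrightarrow> p - q \<in> I"
proof -
  interpret ideal I "poly_ring V" by fact
  show 1: "I \<subseteq> carrier (poly_ring V)" "0 \<in> I"
    "r \<in> carrier (poly_ring V) \<Longrightarrow> p \<in> I \<Longrightarrow> r * p \<in> I"
    using a_subset I_l_closed additive_subgroup.zero_closed[OF additive_subgroup_axioms] by auto
  have add: "p \<in> I \<Longrightarrow> q \<in> I \<Longrightarrow> p + q \<in> I" for p q
    using additive_subgroup.a_closed[OF additive_subgroup_axioms] by auto
  then show "p \<in> I \<Longrightarrow> q \<in> I \<Longrightarrow> p + q \<in> I" .
  show "p \<in> I \<Longrightarrow> q \<in> I \<Longrightarrow> p - q \<in> I"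
    using 1(1) add[of p "- q"] additive_subgroup.a_inv_closed[OF additive_subgroup_axioms, of q]
      poly_ring_a_inv[of q V] by auto
qed

section \<open>Monomials and degrees\<close>

lemma mono_degree_superset:
  assumes "finite A" "Poly_Mapping.keys m \<subseteq> A"
  shows "mono_degree m = (\<Sum>v \<in> A. Poly_Mapping.lookup m v)"
  unfolding mono_degree_def using assms
  by (intro sum.mono_neutral_left) (auto simp: in_keys_iff)

lemma mono_degree_0 [simp]: "mono_degree 0 = 0"
  by (simp add: mono_degree_def)

lemma mono_degree_single [simp]: "mono_degree (Poly_Mapping.single v n) = n"
  by (subst mono_degree_superset[of "{v}"]) auto

lemma mono_degree_add [simp]: "mono_degree (m + n) = mono_degree m + mono_degree n"
proof -
  let ?A = "Poly_Mapping.keys m \<union> Poly_Mapping.keys n"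
  have "mono_degree r = (\<Sum>v \<in> ?A. Poly_Mapping.lookup r v)" if "Poly_Mapping.keys r \<subseteq> ?A" for r
    using that by (intro mono_degree_superset) auto
  then show ?thesis
    by (simp add: keys_add lookup_add sum.distrib)
qed

lemma mono_degree_sum [simp]: "mono_degree (sum g A) = (\<Sum>x\<in>A. mono_degree (g x))"
  by (induction A rule: infinite_finite_induct) auto

lemma forms_eq:
  "forms V k = {p. Poly_Mapping.keys p \<subseteq> {m. Poly_Mapping.keys m \<subseteq> V \<and> mono_degree m = k}}"
  by (auto simp: forms_def carrier_poly_ring)

lemma forms_carrier: "p \<in> forms V k \<Longrightarrow> p \<in> carrier (poly_ring V)"
  by (simp add: forms_def)

lemma forms_single:
  "Poly_Mapping.keys m \<subseteq> V \<Longrightarrow> mono_degree m = k \<Longrightarrow> Poly_Mapping.single m c \<in> forms V k"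
  by (auto simp: forms_eq)

lemma forms_add: "p \<in> forms V k \<Longrightarrow> q \<in> forms V k \<Longrightarrow> p + q \<in> forms V k"
  unfolding forms_eq using keys_add[of p q] by blast

lemma forms_minus:
  assumes "p \<in> forms V k" "q \<in> forms V k"
  shows "p - q \<in> forms V k"
proof -
  have "Poly_Mapping.keys (p - q) \<subseteq> Poly_Mapping.keys p \<union> Poly_Mapping.keys q"
    by (auto simp: in_keys_iff lookup_minus)
  with assms show ?thesis unfolding forms_eq by blast
qed

lemma forms_zero [simp]: "0 \<in> forms V k"
  by (simp add: forms_eq)

lemma forms_sum: "(\<And>i. i \<in> I \<Longrightarrow> g i \<in> forms V k) \<Longrightarrow> sum g I \<in> forms V k"
  by (induction I rule: infinite_finite_induct) (auto intro: forms_add)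

lemma lookup_sum_single:
  assumes "finite A" "\<And>v. v \<in> A \<Longrightarrow> g v = g w \<Longrightarrow> v = w"
  shows "Poly_Mapping.lookup (\<Sum>v\<in>A. Poly_Mapping.single (g v) n) (g w) = (if w \<in> A then n else 0)"
proof -
  have "Poly_Mapping.lookup (\<Sum>v\<in>A. Poly_Mapping.single (g v) n) (g w) =
      (\<Sum>v\<in>A. if v = w then n else 0)"
    unfolding lookup_sum using assms(2) by (intro sum.cong) (auto simp: lookup_single when_def)
  then show ?thesis by (simp add: assms(1))
qed

section \<open>Annihilators by means of divided powers\<close>

text \<open>
  In characteristic \<open>0\<close> the coefficients with respect to the divided powers \<open>v^n / n!\<close> turn
  differentiation into a shift of the exponents, and nothing else about \<open>mp_act\<close> is needed.
\<close>

definition divided_coeff :: "('x, 'k::field_char_0) mpoly \<Rightarrow> ('x \<Rightarrow>\<^sub>0 nat) \<Rightarrow> 'k" where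
  "divided_coeff f n =
     (\<Prod>v \<in> Poly_Mapping.keys n. fact (Poly_Mapping.lookup n v)) * Poly_Mapping.lookup f n"

text \<open>The factor \<open>n v + 1\<close> produced by the derivative completes the factorial of
  \<open>n v\<close> to that of \<open>n v + 1\<close>, while all other factorials stay the
  same.\<close>

lemma divided_coeff_deriv:
  "divided_coeff (mp_deriv v f) n = divided_coeff f (n + Poly_Mapping.single v 1)"
proof -
  let ?A = "insert v (Poly_Mapping.keys n)"
  let ?f = "\<lambda>n w. fact (Poly_Mapping.lookup n w) :: 'a"
  \<comment> \<open>The factor of \<open>v\<close> is split off over the common index set
    \<open>?A\<close>, because \<open>v\<close> need not occur in \<open>n\<close>.\<close>
  have *: "(\<Prod>w \<in> Poly_Mapping.keys m. ?f m w) = ?f m v * (\<Prod>w \<in> ?A - {v}. ?f m w)"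
    if "Poly_Mapping.keys m \<subseteq> ?A" for m
  proof -
    have "(\<Prod>w \<in> Poly_Mapping.keys m. ?f m w) = (\<Prod>w \<in> ?A. ?f m w)"
      using that by (intro prod.mono_neutral_left) (auto simp: in_keys_iff)
    then show ?thesis
      by (simp add: prod.insert_remove)
  qed
  have keys: "Poly_Mapping.keys (n + Poly_Mapping.single v 1) \<subseteq> ?A"
    using keys_add[of n "Poly_Mapping.single v 1"] by auto
  have "(\<Prod>w \<in> ?A - {v}. ?f (n + Poly_Mapping.single v 1) w) = (\<Prod>w \<in> ?A - {v}. ?f n w)"
    by (intro prod.cong) (auto simp: lookup_add lookup_single)
  then show ?thesis
    unfolding divided_coeff_def *[OF keys] *[OF subset_insertI]
    by (simp add: lookup_mp_deriv lookup_add algebra_simps)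
qed

lemma divided_coeff_deriv_funpow:
  "divided_coeff ((mp_deriv v ^^ k) f) n = divided_coeff f (n + Poly_Mapping.single v k)"
proof (induction k arbitrary: n)
  case (Suc k)
  then show ?case
    by (simp add: divided_coeff_deriv add.assoc flip: single_add)
qed simp

text \<open>Powers of derivatives commute, so the fold can be unrolled one variable at a time; each
  variable adds its own part of \<open>m\<close> to the shift.\<close>

lemma divided_coeff_mono_act:
  fixes f :: "('x, 'k::field_char_0) mpoly"
  shows "divided_coeff (mono_act m f) n = divided_coeff f (n + m)"
proof -
  interpret comp_fun_commute "mp_deriv :: _ \<Rightarrow> ('x, 'k) mpoly \<Rightarrow> _"
    by standard (auto simp: mp_deriv_commute)
  interpret comp_fun_commute "\<lambda>v. (mp_deriv v :: ('x, 'k) mpoly \<Rightarrow> _) ^^ Poly_Mapping.lookup m v"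
    by (rule comp_fun_commute_funpow)
  have "divided_coeff (Finite_Set.fold (\<lambda>v. mp_deriv v ^^ Poly_Mapping.lookup m v) f A) n =
      divided_coeff f (n + (\<Sum>v\<in>A. Poly_Mapping.single v (Poly_Mapping.lookup m v)))"
    if "finite A" for A
    using that
    by (induction A arbitrary: n rule: finite_induct)
      (simp_all add: divided_coeff_deriv_funpow add_ac)
  moreover have "(\<Sum>v\<in>Poly_Mapping.keys m. Poly_Mapping.single v (Poly_Mapping.lookup m v)) = m"
    by (rule poly_mapping_eqI)
      (auto simp: lookup_sum lookup_single when_def in_keys_iff sum.delta)
  ultimately show ?thesis by (simp add: mono_act_def)
qed

text \<open>The linear functional with values \<open>\<phi>\<close> on monomials, applied to the
  product of the monomial \<open>n\<close> with the given polynomial. For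
  \<open>\<phi> = divided_coeff f\<close> it computes the divided coefficients of
  \<open>mp_act p f\<close>.\<close>

definition pairing :: "(('x \<Rightarrow>\<^sub>0 nat) \<Rightarrow> 'k) \<Rightarrow> ('x \<Rightarrow>\<^sub>0 nat) \<Rightarrow> ('x, 'k::field) mpoly \<Rightarrow> 'k" where
  "pairing \<phi> n = extend (\<lambda>m c. c * \<phi> (n + m))"

lemma pairing_0 [simp]: "pairing \<phi> n 0 = 0"
  by (simp add: pairing_def)

lemma pairing_single [simp]: "pairing \<phi> n (Poly_Mapping.single m c) = c * \<phi> (n + m)"
  by (simp add: pairing_def extend_single)

lemma pairing_add [simp]: "pairing \<phi> n (p + q) = pairing \<phi> n p + pairing \<phi> n q"
  by (simp add: pairing_def extend_add distrib_right)

lemma pairing_sum [simp]: "pairing \<phi> n (sum g A) = (\<Sum>x\<in>A. pairing \<phi> n (g x))"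
  by (induction A rule: infinite_finite_induct) auto

lemma pairing_single_mult:
  "pairing \<phi> n (Poly_Mapping.single m c * p) = c * pairing \<phi> (n + m) p"
  by (induction p rule: poly_mapping_single_induct[OF subset_UNIV])
    (simp_all add: mult_single distrib_left add.assoc)

text \<open>Multiplication by a term only shifts \<open>n\<close> and scales, so vanishing for every
  \<open>n\<close> passes to all multiples. This is the ideal property of annihilators.\<close>

lemma pairing_mult_eq_0:
  assumes "\<And>n. pairing \<phi> n p = 0"
  shows "pairing \<phi> n (r * p) = 0"
  by (induction r rule: poly_mapping_single_induct[OF subset_UNIV])
    (simp_all add: pairing_single_mult assms distrib_right)

lemma divided_coeff_mp_act:
  fixes f :: "('x, 'k::field_char_0) mpoly"
  shows "divided_coeff (mp_act p f) n = pairing (divided_coeff f) n p"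
proof -
  have "divided_coeff (mp_const c * g) n = c * divided_coeff g n" for c and g :: "('x, 'k) mpoly"
    by (simp add: divided_coeff_def lookup_const_mult)
  moreover have "divided_coeff (sum g A) n = (\<Sum>x\<in>A. divided_coeff (g x) n)"
    for g :: "_ \<Rightarrow> ('x, 'k) mpoly" and A :: "('x \<Rightarrow>\<^sub>0 nat) set"
    by (simp add: divided_coeff_def lookup_sum sum_distrib_left)
  ultimately show ?thesis
    by (simp add: mp_act_def pairing_def extend_def divided_coeff_mono_act)
qed

lemma divided_coeff_eq_0_iff:
  "divided_coeff (f :: ('x, 'k::field_char_0) mpoly) n = 0 \<longleftrightarrow> Poly_Mapping.lookup f n = 0"
  by (simp add: divided_coeff_def)

text \<open>Factorials are nonzero in characteristic \<open>0\<close>, so a polynomial vanishes as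
  soon as all its divided coefficients do; those of \<open>mp_act p f\<close> are pairings.\<close>

lemma Ann_eq:
  fixes f :: "('x, 'k::field_char_0) mpoly"
  shows "Ann V f = {p \<in> carrier (poly_ring V). \<forall>n. pairing (divided_coeff f) n p = 0}"
proof -
  have "mp_act p f = 0 \<longleftrightarrow> (\<forall>n. divided_coeff (mp_act p f) n = 0)" for p
    unfolding divided_coeff_eq_0_iff by (auto intro: poly_mapping_eqI)
  then show ?thesis
    by (simp add: Ann_def divided_coeff_mp_act)
qed

lemma ideal_Ann:
  fixes f :: "('x, 'k::field_char_0) mpoly"
  shows "ideal (Ann V f) (poly_ring V)"
  unfolding Ann_eq
  by (rule ideal_poly_ringI) (auto simp: poly_ring_add poly_ring_mult pairing_mult_eq_0)

section \<open>Quotients of polynomial rings\<close>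

locale poly_quotient =
  fixes V :: "'x set" and I :: "('x, 'k::field) mpoly set"
  assumes ideal: "ideal I (poly_ring V)"
begin

definition cls :: "('x, 'k) mpoly \<Rightarrow> ('x, 'k) mpoly set" where
  "cls p = I +>\<^bsub>poly_ring V\<^esub> p"

abbreviation Q :: "('k, ('x, 'k) mpoly set) graded_algebra" where
  "Q \<equiv> quotient_algebra V I"

lemma cls_eq_iff:
  assumes "p \<in> carrier (poly_ring V)" "q \<in> carrier (poly_ring V)"
  shows "cls p = cls q \<longleftrightarrow> p - q \<in> I"
proof -
  interpret ideal I "poly_ring V" by (rule ideal)
  show ?thesis
    using quotient_eq_iff_same_a_r_cos[OF ideal assms] assms
    by (simp add: cls_def a_minus_def poly_ring_a_inv)
qed

lemma Q_sel:
  "carrier Q = cls ` carrier (poly_ring V)"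
  "\<one>\<^bsub>Q\<^esub> = cls 1" "\<zero>\<^bsub>Q\<^esub> = cls 0" "grade Q k = cls ` forms V k"
proof -
  interpret ideal I "poly_ring V" by (rule ideal)
  show "carrier Q = cls ` carrier (poly_ring V)" "\<one>\<^bsub>Q\<^esub> = cls 1" "\<zero>\<^bsub>Q\<^esub> = cls 0" "grade Q k = cls ` forms V k"
    using a_coset_add_zero[OF a_subset]
    by (auto simp: quotient_algebra_def Let_def FactRing_def cls_def[abs_def] A_RCOSETS_def')
qed

lemma Q_ops:
  assumes "p \<in> carrier (poly_ring V)" "q \<in> carrier (poly_ring V)"
  shows "cls p \<oplus>\<^bsub>Q\<^esub> cls q = cls (p + q)"
    and "cls p \<otimes>\<^bsub>Q\<^esub> cls q = cls (p * q)"
proof -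
  interpret ideal I "poly_ring V" by (rule ideal)
  show "cls p \<oplus>\<^bsub>Q\<^esub> cls q = cls (p + q)"
    "cls p \<otimes>\<^bsub>Q\<^esub> cls q = cls (p * q)"
    using assms abelian_subgroup.a_rcos_sum
      [OF abelian_subgroupI3[OF additive_subgroup_axioms abelian_group_axioms], of p q]
    by (simp_all add: quotient_algebra_def Let_def FactRing_def cls_def rcoset_mult_add)
qed

lemma Q_smult:
  assumes "p \<in> carrier (poly_ring V)"
  shows "c \<odot>\<^bsub>Q\<^esub> cls p = cls (mp_const c * p)"
proof -
  interpret ideal I "poly_ring V" by (rule ideal)
  show ?thesis
    using assms by (simp add: quotient_algebra_def Let_def FactRing_def cls_def rcoset_mult_add)
qed

lemma ring_Q: "ring Q"
proof (rule ringI)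
  note [simp] = Q_sel Q_ops poly_ring_add poly_ring_mult
  show "abelian_group Q"
  proof (rule abelian_groupI)
    fix x assume "x \<in> carrier Q"
    then obtain p where p: "x = cls p" "p \<in> carrier (poly_ring V)"
      by auto
    then show "\<exists>y\<in>carrier Q. y \<oplus>\<^bsub>Q\<^esub> x = \<zero>\<^bsub>Q\<^esub>"
      by (intro bexI[of _ "cls (- p)"]) (auto simp: poly_ring_uminus)
  qed (auto simp: add_ac)
  show "Group.monoid Q"
    by (rule monoidI) (auto simp: mult_ac)
qed (auto simp: Q_sel Q_ops poly_ring_add poly_ring_mult distrib_left distrib_right)

lemma base_field_Q: "base_field Q = range (\<lambda>c. cls (mp_const c))"
  by (simp add: base_field_def Q_sel Q_smult)

text \<open>Each new element of \<open>B\<close> contributes a line extension of the span built so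
  far. Independence modulo \<open>I\<close> keeps its class outside that span, so the dimension
  grows by one.\<close>

lemma dimension_Q:
  assumes "finite B" "\<And>b. b \<in> B \<Longrightarrow> g b \<in> carrier (poly_ring V)"
    and "\<And>c b. (\<Sum>b\<in>B. mp_const (c b) * g b) \<in> I \<Longrightarrow> b \<in> B \<Longrightarrow> c b = 0"
  shows "ring.dimension Q (card B) (base_field Q)
    {cls (\<Sum>b\<in>B. mp_const (c b) * g b) | c. True}"
  using assms
proof (induction B rule: finite_induct)
  interpret Q: ring Q by (rule ring_Q)
  case empty
  then show ?case
    using Q.zero_dim by (simp add: Q_sel)
next
  interpret Q: ring Q by (rule ring_Q)
  case (insert b B)
  let ?lc = "\<lambda>c. \<Sum>b\<in>B. mp_const (c b) * g b"
  let ?E = "{cls (?lc c) | c. True}"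
  have carrier: "?lc c \<in> carrier (poly_ring V)" "mp_const x * g b \<in> carrier (poly_ring V)" for c x
    using insert.prems(1) by (auto intro!: poly_ring_sum poly_ring_mult)
  have upd: "(\<Sum>x\<in>insert b B. mp_const ((c(b := z)) x) * g x) = mp_const z * g b + ?lc c" for c z
    using insert.hyps by (auto intro!: sum.cong)
  \<comment> \<open>A relation on \<open>B\<close> becomes one on \<open>insert b B\<close> with
    coefficient \<open>0\<close> at \<open>b\<close>.\<close>
  have "c b' = 0" if "?lc c \<in> I" "b' \<in> B" for c b'
  proof -
    have "b' \<noteq> b"
      using that insert.hyps by blast
    then show ?thesis
      using insert.prems(2)[of "c(b := 0)" b'] that unfolding upd by (simp add: mp_const_def)
  qed
  then have E: "Q.dimension (card B) (base_field Q) ?E"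
    using insert by auto
  \<comment> \<open>Membership would yield a relation with coefficient \<open>1\<close> at
    \<open>b\<close>, contradicting independence.\<close>
  have "cls (g b) \<notin> ?E"
  proof
    assume "cls (g b) \<in> ?E"
    then obtain c where "cls (g b) = cls (?lc c)"
      by auto
    then have "g b - ?lc c \<in> I"
      using carrier insert.prems(1) by (simp add: cls_eq_iff)
    also have "g b - ?lc c = mp_const 1 * g b + ?lc (\<lambda>x. - c x)"
      by (simp add: mp_const_def single_uminus sum_negf)
    finally show False
      using insert.prems(2)[of "(\<lambda>x. - c x)(b := 1)" b] unfolding upd by simp
  qed
  then have "Q.dimension (Suc (card B)) (base_field Q)
      (Q.line_extension (base_field Q) (cls (g b)) ?E)"
    using E insert.prems(1) by (intro Q.Suc_dim) (auto simp: Q_sel)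
  also have "Q.line_extension (base_field Q) (cls (g b)) ?E =
      {cls (\<Sum>x\<in>insert b B. mp_const (c x) * g x) | c. True}" (is "?L = ?R")
  proof (intro equalityI subsetI)
    fix u assume "u \<in> ?L"
    then obtain z c where "u = cls (mp_const z) \<otimes>\<^bsub>Q\<^esub> cls (g b) \<oplus>\<^bsub>Q\<^esub> cls (?lc c)"
      by (auto simp: Q.line_extension_mem_iff base_field_Q)
    then have "u = cls (mp_const z * g b + ?lc c)"
      using carrier insert.prems(1) by (simp add: Q_ops)
    then show "u \<in> ?R"
      unfolding upd[symmetric] by blast
  next
    fix u assume "u \<in> ?R"
    then obtain c where "u = cls (\<Sum>x\<in>insert b B. mp_const (c x) * g x)"
      by auto
    then have "u = cls (mp_const (c b)) \<otimes>\<^bsub>Q\<^esub> cls (g b) \<oplus>\<^bsub>Q\<^esub> cls (?lc c)"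
      using carrier insert by (simp add: Q_ops)
    then show "u \<in> ?L"
      by (auto simp: Q.line_extension_mem_iff base_field_Q)
  qed
  finally show ?case
    using insert.hyps by simp
qed

end

section \<open>Renaming of variables\<close>

definition rename_mono :: "('x \<Rightarrow> 'y) \<Rightarrow> ('x \<Rightarrow>\<^sub>0 nat) \<Rightarrow> ('y \<Rightarrow>\<^sub>0 nat)" where
  "rename_mono \<sigma> = extend (\<lambda>v e. Poly_Mapping.single (\<sigma> v) e)"

definition rename :: "('x \<Rightarrow> 'y) \<Rightarrow> ('x, 'k::field) mpoly \<Rightarrow> ('y, 'k) mpoly" where
  "rename \<sigma> = extend (\<lambda>m c. Poly_Mapping.single (rename_mono \<sigma> m) c)"

lemma rename_mono_simps [simp]:
  "rename_mono \<sigma> 0 = 0"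
  "rename_mono \<sigma> (m + n) = rename_mono \<sigma> m + rename_mono \<sigma> n"
  "rename_mono \<sigma> (Poly_Mapping.single v e) = Poly_Mapping.single (\<sigma> v) e"
  by (simp_all add: rename_mono_def extend_add extend_single single_add)

lemma mono_degree_rename_mono [simp]: "mono_degree (rename_mono \<sigma> m) = mono_degree m"
  by (induction m rule: poly_mapping_single_induct[OF subset_UNIV]) auto

lemma keys_rename_mono: "Poly_Mapping.keys (rename_mono \<sigma> m) \<subseteq> \<sigma> ` Poly_Mapping.keys m"
  unfolding rename_mono_def extend_def
  by (rule order_trans[OF keys_sum]) auto

lemma rename_simps [simp]:
  "rename \<sigma> 0 = 0"
  "rename \<sigma> (p + q) = rename \<sigma> p + rename \<sigma> q"
  "rename \<sigma> (p * q) = rename \<sigma> p * rename \<sigma> q"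
  "rename \<sigma> (Poly_Mapping.single m c) = Poly_Mapping.single (rename_mono \<sigma> m) c"
  "rename \<sigma> (mp_const c) = mp_const c"
  by (simp_all add: rename_def extend_add extend_mult extend_single single_add mult_single mp_const_def)

lemma rename_one [simp]: "rename \<sigma> 1 = 1"
  using rename_simps(5)[of \<sigma> 1] by (simp add: mp_const_def del: rename_simps(5))

lemma rename_minus [simp]: "rename \<sigma> (p - q) = rename \<sigma> p - rename \<sigma> q"
  using rename_simps(2)[of \<sigma> "p - q" q] by (simp del: rename_simps(2))

lemma keys_rename: "Poly_Mapping.keys (rename \<sigma> p) \<subseteq> rename_mono \<sigma> ` Poly_Mapping.keys p"
  unfolding rename_def extend_def
  by (rule order_trans[OF keys_sum]) auto

lemma rename_forms:
  assumes "p \<in> forms V k" "\<sigma> ` V \<subseteq> W"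
  shows "rename \<sigma> p \<in> forms W k"
  using assms keys_rename[of \<sigma> p] keys_rename_mono[of \<sigma>] unfolding forms_eq by fastforce

lemma rename_carrier:
  assumes "p \<in> carrier (poly_ring V)" "\<sigma> ` V \<subseteq> W"
  shows "rename \<sigma> p \<in> carrier (poly_ring W)"
  using assms keys_rename[of \<sigma> p] keys_rename_mono[of \<sigma>] unfolding carrier_poly_ring by fastforce

lemma rename_inverse:
  assumes "p \<in> carrier (poly_ring V)" "\<And>v. v \<in> V \<Longrightarrow> \<tau> (\<sigma> v) = v"
  shows "rename \<tau> (rename \<sigma> p) = p"
proof -
  have mono: "rename_mono \<tau> (rename_mono \<sigma> m) = m" if "Poly_Mapping.keys m \<subseteq> V" for m
    using that by (induction m rule: poly_mapping_single_induct) (auto simp: assms(2))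
  have "Poly_Mapping.keys p \<subseteq> {m. Poly_Mapping.keys m \<subseteq> V}"
    using assms(1) by (auto simp: carrier_poly_ring)
  then show ?thesis
    by (induction p rule: poly_mapping_single_induct) (auto simp: mono)
qed

text \<open>The preimage of the target ideal under renaming is an ideal that contains
  \<open>S\<close>, hence it contains the ideal generated by \<open>S\<close>.\<close>

lemma rename_genideal:
  assumes S: "S \<subseteq> carrier (poly_ring V)" and "\<sigma> ` V \<subseteq> W"
    and p: "p \<in> Idl\<^bsub>poly_ring V\<^esub> S"
  shows "rename \<sigma> p \<in> Idl\<^bsub>poly_ring W\<^esub> (rename \<sigma> ` S)"
proof -
  interpret V: cring "poly_ring V" by (rule cring_poly_ring)
  interpret W: cring "poly_ring W" by (rule cring_poly_ring)
  let ?I = "Idl\<^bsub>poly_ring W\<^esub> (rename \<sigma> ` S)"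
  have S': "rename \<sigma> ` S \<subseteq> carrier (poly_ring W)"
    using assms rename_carrier by blast
  note I = ideal_poly_ringD[OF W.genideal_ideal[OF S']]
  have "ideal {q \<in> carrier (poly_ring V). rename \<sigma> q \<in> ?I} (poly_ring V)"
    by (rule ideal_poly_ringI)
      (auto simp: I poly_ring_add poly_ring_mult rename_carrier[OF _ assms(2)])
  moreover have "S \<subseteq> {q \<in> carrier (poly_ring V). rename \<sigma> q \<in> ?I}"
    using S W.genideal_self[OF S'] by auto
  ultimately show ?thesis
    using V.genideal_minimal p by blast
qed

section \<open>Transfer of a quadratic presentation to numbered variables\<close>

text \<open>An enumeration of the finite set \<open>V\<close> renames the variables to natural
  numbers. It is invertible and preserves degrees, so it carries the generated ideal onto the ideal
  of the renamed quadrics and induces a graded isomorphism of the quotients.\<close>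

lemma presented_by_quadricsI:
  fixes S :: "('x, 'k::field) mpoly set"
  assumes "finite V" and S: "S \<subseteq> forms V 2"
  shows "presented_by_quadrics (quotient_algebra V (Idl\<^bsub>poly_ring V\<^esub> S))"
proof -
  let ?W = "{..<card V}"
  obtain \<sigma> where \<sigma>: "bij_betw \<sigma> V ?W"
    using ex_bij_betw_finite_nat[OF \<open>finite V\<close>] by (auto simp: atLeast0LessThan)
  define \<tau> where "\<tau> = inv_into V \<sigma>"
  have \<tau>: "\<tau> ` ?W \<subseteq> V" "\<And>v. v \<in> V \<Longrightarrow> \<tau> (\<sigma> v) = v" "\<And>w. w \<in> ?W \<Longrightarrow> \<sigma> (\<tau> w) = w"
    and \<sigma>': "\<sigma> ` V \<subseteq> ?W"
    using \<sigma> bij_betw_inv_into[OF \<sigma>]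
    by (auto simp: \<tau>_def bij_betw_inv_into_left bij_betw_inv_into_right bij_betw_def)
  let ?S = "rename \<sigma> ` S"
  let ?I = "Idl\<^bsub>poly_ring V\<^esub> S" and ?J = "Idl\<^bsub>poly_ring ?W\<^esub> ?S"
  have S_carrier: "S \<subseteq> carrier (poly_ring V)"
    using S forms_carrier by blast
  have S2: "?S \<subseteq> forms ?W 2"
    using S \<sigma>' by (auto intro: rename_forms)
  then have S2_carrier: "?S \<subseteq> carrier (poly_ring ?W)"
    using forms_carrier by blast
  interpret V: cring "poly_ring V :: ('x, 'k) mpoly ring" by (rule cring_poly_ring)
  interpret W: cring "poly_ring ?W :: (nat, 'k) mpoly ring" by (rule cring_poly_ring)
  interpret A: poly_quotient V ?I
    by (rule poly_quotient.intro[OF V.genideal_ideal[OF S_carrier]])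
  interpret B: poly_quotient ?W ?J
    by (rule poly_quotient.intro[OF W.genideal_ideal[OF S2_carrier]])
  have inv: "rename \<tau> (rename \<sigma> p) = p" if "p \<in> carrier (poly_ring V)" for p :: "('x, 'k) mpoly"
    using that \<tau>(2) by (rule rename_inverse)
  have inv': "rename \<sigma> (rename \<tau> p) = p" if "p \<in> carrier (poly_ring ?W)" for p :: "(nat, 'k) mpoly"
    using that \<tau>(3) by (rule rename_inverse)
  have "rename \<tau> ` ?S = S"
    using S_carrier inv by (force simp: image_image)
  \<comment> \<open>Renaming by \<open>\<sigma>\<close> gives one direction, renaming back by
    \<open>\<tau>\<close> the other.\<close>
  then have J_iff: "rename \<sigma> p \<in> ?J \<longleftrightarrow> p \<in> ?I" if "p \<in> carrier (poly_ring V)" for p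
    using rename_genideal[OF S_carrier \<sigma>', of p] rename_genideal[OF S2_carrier \<tau>(1), of "rename \<sigma> p"]
      inv[OF that] by auto
  have img: "rename \<sigma> ` ?I = ?J"
  proof (intro equalityI subsetI)
    fix q assume q: "q \<in> ?J"
    then have "q \<in> carrier (poly_ring ?W)"
      using ideal_poly_ringD(1)[OF B.ideal] by auto
    then show "q \<in> rename \<sigma> ` ?I"
      using q J_iff[of "rename \<tau> q"] inv'[of q] rename_carrier[OF _ \<tau>(1), of q]
      by (intro image_eqI[of _ _ "rename \<tau> q"]) auto
  qed (use ideal_poly_ringD(1)[OF A.ideal] J_iff in auto)
  \<comment> \<open>Classes are sets of polynomials, so the isomorphism is simply the image map of
    \<open>rename \<sigma>\<close>; since the ideals correspond, cosets go to cosets.\<close>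
  have h: "rename \<sigma> ` A.cls p = B.cls (rename \<sigma> p)" for p
    unfolding A.cls_def B.cls_def
    unfolding a_r_coset_def' img[symmetric] by (auto simp: image_iff)
  have image_eq: "rename \<sigma> ` X = Y" if "\<And>p. p \<in> X \<Longrightarrow> rename \<sigma> p \<in> Y"
    "\<And>q. q \<in> Y \<Longrightarrow> rename \<tau> q \<in> X" "Y \<subseteq> carrier (poly_ring ?W)" for X and Y :: "(nat, 'k) mpoly set"
  proof (intro equalityI subsetI)
    fix q assume "q \<in> Y"
    with that(2,3) inv'[of q] show "q \<in> rename \<sigma> ` X"
      by (intro image_eqI[of _ _ "rename \<tau> q"]) auto
  qed (use that(1) in auto)
  note to_W = rename_carrier[OF _ \<sigma>'] rename_forms[OF _ \<sigma>']
  note to_V = rename_carrier[OF _ \<tau>(1)] rename_forms[OF _ \<tau>(1)]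
  have surj: "rename \<sigma> ` carrier (poly_ring V) = (carrier (poly_ring ?W) :: (nat, 'k) mpoly set)"
    by (intro image_eq to_W to_V) auto
  have surj_forms: "rename \<sigma> ` forms V k = (forms ?W k :: (nat, 'k) mpoly set)" for k
    by (intro image_eq to_W to_V) (auto intro: forms_carrier)
  note carr = to_W(1) poly_ring_add poly_ring_mult
  have "image (rename \<sigma>) \<in> graded_iso (quotient_algebra V ?I) (quotient_algebra ?W ?J)"
    unfolding graded_iso_def
  proof (intro CollectI conjI ring_iso_memI ballI allI)
    show "bij_betw (image (rename \<sigma>)) (carrier A.Q) (carrier B.Q)"
      unfolding bij_betw_def
    proof
      show "inj_on (image (rename \<sigma>)) (carrier A.Q)"
      proof (rule inj_onI)
        fix x y assume xy: "x \<in> carrier A.Q" "y \<in> carrier A.Q" "rename \<sigma> ` x = rename \<sigma> ` y"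
        then obtain p q where "x = A.cls p" "y = A.cls q"
          and pq: "p \<in> carrier (poly_ring V)" "q \<in> carrier (poly_ring V)"
          by (auto simp: A.Q_sel)
        with xy(3) J_iff[of "p - q"] show "x = y"
          by (simp add: h B.cls_eq_iff A.cls_eq_iff carr poly_ring_minus)
      qed
      show "image (rename \<sigma>) ` carrier A.Q = carrier B.Q"
        by (simp add: A.Q_sel B.Q_sel image_image h flip: surj)
    qed
    show "image (rename \<sigma>) ` grade A.Q k = grade B.Q k" for k
      by (simp add: A.Q_sel B.Q_sel image_image h flip: surj_forms)
  qed (auto simp: A.Q_sel B.Q_sel h A.Q_ops B.Q_ops A.Q_smult B.Q_smult carr del: equalityI)
  then show ?thesis
    unfolding presented_by_quadrics_def using S2 by blast
qed

section \<open>Faces of the Turan complex\<close>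

lemma finite_turan_vertices [simp]: "finite (turan_vertices d a)"
  by (simp add: turan_vertices_def)

text \<open>A transversal is the graph of its choice function, which is recovered by inverting
  \<open>fst\<close> on \<open>F\<close>. Subsets and exchanges of vertices are easier to treat in
  terms of \<open>fst\<close>.\<close>

lemma turan_facet_iff:
  "F \<in> turan_facets d a \<longleftrightarrow> F \<subseteq> turan_vertices d a \<and> bij_betw fst F {1..<d}"
proof
  assume "F \<in> turan_facets d a"
  then obtain c where c: "c \<in> (\<Pi>\<^sub>E i \<in> {1..<d}. {1..a i})" "F = (\<lambda>i. (i, c i)) ` {1..<d}"
    unfolding turan_facets_def by blast
  have "F \<subseteq> turan_vertices d a"
    using PiE_mem[OF c(1)] unfolding c(2) turan_vertices_def by blast
  moreover have "bij_betw fst F {1..<d}"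
    unfolding c(2) bij_betw_def by (simp add: inj_on_def image_image)
  ultimately show "F \<subseteq> turan_vertices d a \<and> bij_betw fst F {1..<d}" ..
next
  assume F: "F \<subseteq> turan_vertices d a \<and> bij_betw fst F {1..<d}"
  define c where "c = restrict (\<lambda>i. snd (inv_into F fst i)) {1..<d}"
  have inv: "inv_into F fst i = (i, c i)" "(i, c i) \<in> F" if "i \<in> {1..<d}" for i
  proof -
    have "i \<in> fst ` F"
      using F that by (simp add: bij_betw_def)
    then have "inv_into F fst i \<in> F" "fst (inv_into F fst i) = i"
      by (rule inv_into_into, rule f_inv_into_f)
    moreover from this(2) that show "inv_into F fst i = (i, c i)"
      by (simp add: c_def prod_eq_iff)
    ultimately show "(i, c i) \<in> F"
      by simp
  qed
  have "x \<in> (\<lambda>i. (i, c i)) ` {1..<d}" if "x \<in> F" for x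
  proof -
    have "fst x \<in> {1..<d}" "inv_into F fst (fst x) = x"
      using F that by (auto simp: bij_betw_def)
    with inv(1) show ?thesis by (metis imageI)
  qed
  with inv(2) have "F = (\<lambda>i. (i, c i)) ` {1..<d}"
    by blast
  moreover have "c \<in> (\<Pi>\<^sub>E i \<in> {1..<d}. {1..a i})"
  proof (rule PiE_I)
    show "c i \<in> {1..a i}" if "i \<in> {1..<d}" for i
      using F inv(2)[OF that] by (auto simp: turan_vertices_def)
  qed (auto simp: c_def)
  ultimately show "F \<in> turan_facets d a"
    unfolding turan_facets_def by blast
qed

lemma finite_turan_facets [simp]: "finite (turan_facets d a)"
  by (rule finite_subset[of _ "Pow (turan_vertices d a)"]) (auto simp: turan_facet_iff)

lemma turan_facet_swap:
  assumes "F \<in> turan_facets d a" "v \<in> F" "w \<in> turan_vertices d a" "fst w = fst v"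
  shows "insert w (F - {v}) \<in> turan_facets d a"
proof -
  have "inj_on fst F" "fst ` F = {1..<d}"
    using assms(1) by (auto simp: turan_facet_iff bij_betw_def)
  moreover have "fst w \<notin> fst ` (F - {v})"
    using \<open>inj_on fst F\<close> assms(2,4) by (auto dest: inj_onD)
  moreover have "fst ` insert w (F - {v}) = fst ` F"
    using assms(2,4) by force
  ultimately show ?thesis
    using assms by (auto simp: turan_facet_iff bij_betw_def inj_on_insert intro: inj_on_diff)
qed

lemma turan_facet_eqI:
  assumes "F \<in> turan_facets d a" "G \<in> turan_facets d a" "F \<subseteq> G"
  shows "F = G"
  using card_turan_facet[OF assms(1)] card_turan_facet[OF assms(2)] assms(3)
  by (metis card_subset_eq)

lemma turan_face_finite: "S \<in> turan_complex d a \<Longrightarrow> finite S"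
  using card_turan_facet(1) by (auto simp: turan_complex_def intro: finite_subset)

lemma finite_turan_complex [simp]: "finite (turan_complex d a)"
  using card_turan_facet(1) by (auto simp: turan_complex_def)

lemma turan_face_card_le: "S \<in> turan_complex d a \<Longrightarrow> card S \<le> d - 1"
proof -
  assume "S \<in> turan_complex d a"
  then obtain F where "F \<in> turan_facets d a" "S \<subseteq> F"
    by (auto simp: turan_complex_def)
  then show ?thesis
    using card_turan_facet[of F d a] card_mono[of F S] by simp
qed

text \<open>A partial transversal extends to a full one because no class of vertices is
  empty.\<close>

lemma turan_face_iff:
  assumes "\<And>i. i \<in> {1..<d} \<Longrightarrow> 1 \<le> a i"
  shows "S \<in> turan_complex d a \<longleftrightarrow> S \<subseteq> turan_vertices d a \<and> inj_on fst S"
proof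
  assume "S \<in> turan_complex d a"
  then obtain F where "F \<in> turan_facets d a" "S \<subseteq> F"
    by (auto simp: turan_complex_def)
  then show "S \<subseteq> turan_vertices d a \<and> inj_on fst S"
    using inj_on_subset[of fst F S] by (auto simp: turan_facet_iff bij_betw_def)
next
  assume S: "S \<subseteq> turan_vertices d a \<and> inj_on fst S"
  \<comment> \<open>Each class missed by \<open>S\<close> contributes its vertex \<open>1\<close>,
    which exists because \<open>a i\<close> is at least \<open>1\<close>.\<close>
  let ?F = "S \<union> (\<lambda>i. (i, 1)) ` ({1..<d} - fst ` S)"
  have "?F \<in> turan_facets d a"
    unfolding turan_facet_iff bij_betw_def
  proof (intro conjI)
    show "?F \<subseteq> turan_vertices d a"
      using S assms by (auto simp: turan_vertices_def)
    show "inj_on fst ?F"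
    proof -
      have "fst ` (\<lambda>i. (i, 1::nat)) ` ({1..<d} - fst ` S) \<inter> fst ` S = {}"
        by (auto simp: image_image)
      then have "fst ` (S - B) \<inter> fst ` (B - S) = {}"
        if "B = (\<lambda>i. (i, 1::nat)) ` ({1..<d} - fst ` S)" for B
        using that by blast
      then show ?thesis
        using S by (simp add: inj_on_Un) (simp add: inj_on_def)
    qed
    show "fst ` ?F = {1..<d}"
    proof -
      have "fst ` S \<subseteq> {1..<d}"
        using S by (auto simp: turan_vertices_def)
      then show ?thesis
        by (simp add: image_Un image_image Un_absorb1)
    qed
  qed
  then show "S \<in> turan_complex d a"
    by (auto simp: turan_complex_def)
qed

section \<open>Enumeration of the faces\<close>

text \<open>Faces are grouped by the set \<open>I\<close> of classes that they meet. The faces over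
  \<open>I\<close> are the graphs of the choice functions on \<open>I\<close>, which number the
  product of the \<open>a i\<close>; summing over all \<open>I\<close> of size \<open>k\<close>
  gives the elementary symmetric polynomial.\<close>

lemma card_turan_faces:
  assumes "\<And>i. i \<in> {1..<d} \<Longrightarrow> 1 \<le> a i"
  shows "card {S \<in> turan_complex d a. card S = k} = elem_sym d a k"
proof -
  have face_iff: "S \<in> turan_complex d a \<longleftrightarrow> S \<subseteq> turan_vertices d a \<and> inj_on fst S" for S
    by (rule turan_face_iff) (rule assms)
  let ?\<I> = "{I. I \<subseteq> {1..<d} \<and> card I = k}"
  let ?X = "\<lambda>I. {S \<in> turan_complex d a. fst ` S = I}"
  have "card (?X I) = (\<Prod>i\<in>I. a i)" if I: "I \<subseteq> {1..<d}" for I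
  proof -
    have "finite I" using I finite_subset by blast
    have "bij_betw (\<lambda>c. (\<lambda>i. (i, c i)) ` I) (\<Pi>\<^sub>E i\<in>I. {1..a i}) (?X I)"
      unfolding bij_betw_def
    proof (intro conjI inj_onI equalityI subsetI)
      fix c c' assume c: "c \<in> (\<Pi>\<^sub>E i\<in>I. {1..a i})" "c' \<in> (\<Pi>\<^sub>E i\<in>I. {1..a i})"
        "(\<lambda>i. (i, c i)) ` I = (\<lambda>i. (i, c' i)) ` I"
      have "c i = c' i" if "i \<in> I" for i
      proof -
        have "(i, c i) \<in> (\<lambda>i. (i, c' i)) ` I"
          using that unfolding c(3)[symmetric] by blast
        then show ?thesis by auto
      qed
      then show "c = c'"
        by (rule PiE_ext[OF c(1,2)])
    next
      fix S assume "S \<in> (\<lambda>c. (\<lambda>i. (i, c i)) ` I) ` (\<Pi>\<^sub>E i\<in>I. {1..a i})"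
      then obtain c where c: "c \<in> (\<Pi>\<^sub>E i\<in>I. {1..a i})" "S = (\<lambda>i. (i, c i)) ` I"
        by blast
      have "S \<subseteq> turan_vertices d a"
        using I PiE_mem[OF c(1)] unfolding c(2) turan_vertices_def by blast
      moreover have "inj_on fst S" "fst ` S = I"
        unfolding c(2) by (simp_all add: inj_on_def image_image)
      ultimately show "S \<in> ?X I"
        by (simp add: face_iff)
    next
      fix S assume "S \<in> ?X I"
      then have S: "S \<subseteq> turan_vertices d a" "inj_on fst S" "fst ` S = I"
        by (simp_all add: face_iff)
      define c where "c = restrict (\<lambda>i. snd (inv_into S fst i)) I"
      have c: "(i, c i) \<in> S" if "i \<in> I" for i
      proof -
        have "i \<in> fst ` S"
          using S(3) that by simp
        then have "inv_into S fst i \<in> S" "fst (inv_into S fst i) = i"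
          by (rule inv_into_into, rule f_inv_into_f)
        moreover from this(2) that have "inv_into S fst i = (i, c i)"
          by (simp add: c_def prod_eq_iff)
        ultimately show ?thesis
          by simp
      qed
      have "x \<in> (\<lambda>i. (i, c i)) ` I" if "x \<in> S" for x
      proof (rule image_eqI)
        show "fst x \<in> I"
          using S(3) that by blast
        then show "x = (fst x, c (fst x))"
          using inv_into_f_f[OF S(2) that] by (simp add: c_def prod_eq_iff)
      qed
      with c have "S = (\<lambda>i. (i, c i)) ` I"
        by blast
      moreover have "c \<in> (\<Pi>\<^sub>E i\<in>I. {1..a i})"
      proof (rule PiE_I)
        show "c i \<in> {1..a i}" if "i \<in> I" for i
          using S(1) c[OF that] by (auto simp: turan_vertices_def)
      qed (auto simp: c_def)
      ultimately show "S \<in> (\<lambda>c. (\<lambda>i. (i, c i)) ` I) ` (\<Pi>\<^sub>E i\<in>I. {1..a i})"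
        by (rule image_eqI)
    qed
    then have "card (\<Pi>\<^sub>E i\<in>I. {1..a i}) = card (?X I)"
      by (rule bij_betw_same_card)
    then show ?thesis
      using \<open>finite I\<close> by (simp add: card_PiE)
  qed
  moreover have "{S \<in> turan_complex d a. card S = k} = (\<Union>I\<in>?\<I>. ?X I)"
  proof (intro equalityI subsetI)
    fix S assume S: "S \<in> {S \<in> turan_complex d a. card S = k}"
    then have "S \<subseteq> turan_vertices d a" "inj_on fst S"
      using face_iff[of S] by blast+
    then have "fst ` S \<in> ?\<I>"
      using S card_image[of fst S] by (auto simp: turan_vertices_def)
    with S show "S \<in> (\<Union>I\<in>?\<I>. ?X I)"
      by blast
  next
    fix S assume "S \<in> (\<Union>I\<in>?\<I>. ?X I)"
    then have "S \<in> turan_complex d a" "card (fst ` S) = k"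
      by blast+
    then show "S \<in> {S \<in> turan_complex d a. card S = k}"
      using face_iff[of S] card_image[of fst S] by simp
  qed
  moreover have "card (\<Union>I\<in>?\<I>. ?X I) = (\<Sum>I\<in>?\<I>. card (?X I))"
    by (rule card_UN_disjoint) auto
  ultimately show ?thesis
    by (simp add: elem_sym_def)
qed

section \<open>Monomials of the Turan algebra\<close>

definition vertex_mono :: "'v set \<Rightarrow> ('v cvar \<Rightarrow>\<^sub>0 nat)" where
  "vertex_mono S = (\<Sum>v\<in>S. Poly_Mapping.single (VertexVar v) 1)"

text \<open>The monomial \<open>X_F U_S\<close>. For \<open>S = F\<close> it is the term of the form
  that belongs to the facet \<open>F\<close>.\<close>

definition facet_mono :: "'v set \<Rightarrow> 'v set \<Rightarrow> ('v cvar \<Rightarrow>\<^sub>0 nat)" where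
  "facet_mono F S = Poly_Mapping.single (FacetVar F) 1 + vertex_mono S"

lemma lookup_vertex_mono:
  assumes "finite S"
  shows "Poly_Mapping.lookup (vertex_mono S) (VertexVar v) = (if v \<in> S then 1 else 0)"
    and "Poly_Mapping.lookup (vertex_mono S) (FacetVar F) = 0"
  unfolding vertex_mono_def using assms
  by (subst lookup_sum_single) (auto simp: lookup_sum lookup_single)

lemma lookup_facet_mono:
  assumes "finite S"
  shows "Poly_Mapping.lookup (facet_mono F S) (VertexVar v) = (if v \<in> S then 1 else 0)"
    and "Poly_Mapping.lookup (facet_mono F S) (FacetVar G) = (if F = G then 1 else 0)"
  by (simp_all add: facet_mono_def lookup_add lookup_vertex_mono[OF assms] lookup_single)

lemma vertex_mono_disjoint:
  "finite S \<Longrightarrow> finite T \<Longrightarrow> S \<inter> T = {} \<Longrightarrow> vertex_mono (S \<union> T) = vertex_mono S + vertex_mono T"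
  by (simp add: vertex_mono_def sum.union_disjoint)

lemma vertex_mono_remove:
  "finite S \<Longrightarrow> v \<in> S \<Longrightarrow> vertex_mono S = Poly_Mapping.single (VertexVar v) 1 + vertex_mono (S - {v})"
  by (simp add: vertex_mono_def sum.remove)

lemma mono_degree_vertex_mono [simp]: "mono_degree (vertex_mono S) = card S"
  by (simp add: vertex_mono_def)

lemma mono_degree_facet_mono [simp]: "mono_degree (facet_mono F S) = Suc (card S)"
  by (simp add: facet_mono_def)

text \<open>The facet variable identifies \<open>F\<close> with \<open>G\<close>. As all exponents
  on the right are at most \<open>1\<close>, the vertex sets \<open>S\<close> and \<open>T\<close>
  cannot overlap and together fill \<open>G\<close>.\<close>

lemma vertex_facet_mono_eq_iff:
  assumes "finite S" "finite T" "finite G"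
  shows "vertex_mono S + facet_mono F T = facet_mono G G \<longleftrightarrow> F = G \<and> S \<inter> T = {} \<and> S \<union> T = G"
    (is "?L \<longleftrightarrow> ?R")
proof
  assume ?L
  then have eq: "Poly_Mapping.lookup (vertex_mono S + facet_mono F T) x =
      Poly_Mapping.lookup (facet_mono G G) x" for x
    by simp
  have "F = G"
    using eq[of "FacetVar F"] assms
    by (auto simp: lookup_add lookup_vertex_mono lookup_facet_mono split: if_splits)
  moreover have "(if v \<in> S then 1 else 0) + (if v \<in> T then 1 else 0) = (if v \<in> G then 1 else (0::nat))" for v
    using eq[of "VertexVar v"] assms by (simp add: lookup_add lookup_vertex_mono lookup_facet_mono)
  then have "v \<in> S \<and> v \<in> T \<longrightarrow> False" "v \<in> S \<or> v \<in> T \<longleftrightarrow> v \<in> G" for v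
    by (metis add_cancel_right_left one_neq_zero add_is_0)+
  ultimately show ?R by blast
next
  assume ?R
  then show ?L
    using assms vertex_mono_disjoint[of S T] by (auto simp: facet_mono_def add_ac)
qed

lemma prod_single_one:
  "(\<Prod>x\<in>A. Poly_Mapping.single (g x) 1 :: 'a::comm_monoid_add \<Rightarrow>\<^sub>0 'b::comm_semiring_1) =
    Poly_Mapping.single (sum g A) 1"
  by (induction A rule: infinite_finite_induct) (simp_all add: mult_single)

text \<open>The terms of the form are square-free, so all factorials involved are \<open>1\<close>,
  and different facets give different monomials because of their facet variables.\<close>

lemma divided_coeff_complex_form:
  assumes "finite (facets \<Delta>)" and fin: "\<And>F. F \<in> facets \<Delta> \<Longrightarrow> finite F"
  shows "divided_coeff (complex_form \<Delta> :: ('v cvar, 'k::field_char_0) mpoly) n =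
    (if n \<in> (\<lambda>F. facet_mono F F) ` facets \<Delta> then 1 else 0)"
proof -
  have form: "(complex_form \<Delta> :: ('v cvar, 'k) mpoly) =
      (\<Sum>F\<in>facets \<Delta>. Poly_Mapping.single (facet_mono F F) 1)"
    unfolding complex_form_def mp_var_def prod_single_one mult_single
    by (simp add: facet_mono_def vertex_mono_def)
  show ?thesis
  proof (cases "n \<in> (\<lambda>F. facet_mono F F) ` facets \<Delta>")
    case True
    then obtain F where F: "F \<in> facets \<Delta>" "n = facet_mono F F"
      by auto
    have "facet_mono G G = facet_mono F F \<longleftrightarrow> G = F" if "G \<in> facets \<Delta>" for G
      using lookup_facet_mono(2)[OF fin[OF that], of G F] lookup_facet_mono(2)[OF fin[OF F(1)], of F F]
      by (auto split: if_splits)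
    then have "Poly_Mapping.lookup (complex_form \<Delta> :: ('v cvar, 'k) mpoly) n =
        (\<Sum>G\<in>facets \<Delta>. if G = F then 1 else 0)"
      unfolding form lookup_sum F(2) by (intro sum.cong) (auto simp: lookup_single)
    then have "Poly_Mapping.lookup (complex_form \<Delta> :: ('v cvar, 'k) mpoly) n = 1"
      using assms F(1) by simp
    moreover have "fact (Poly_Mapping.lookup n x) = (1 :: 'k)" for x
      using lookup_facet_mono[OF fin[OF F(1)], of F] F(2) by (cases x) auto
    ultimately show ?thesis
      using True by (simp add: divided_coeff_def)
  next
    case False
    then have "Poly_Mapping.lookup (complex_form \<Delta> :: ('v cvar, 'k) mpoly) n = 0"
      unfolding form lookup_sum by (intro sum.neutral) (auto simp: lookup_single when_def)
    with False show ?thesis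
      by (simp add: divided_coeff_def)
  qed
qed

section \<open>The quadratic relations and the normal forms\<close>

text \<open>Pairs of variables whose product divides no term of the form. Every variable is
  incompatible with itself, so the squares are among the relations.\<close>

fun incompatible :: "(nat \<times> nat) cvar \<Rightarrow> (nat \<times> nat) cvar \<Rightarrow> bool" where
  "incompatible (FacetVar F) (FacetVar G) \<longleftrightarrow> True"
| "incompatible (VertexVar v) (VertexVar w) \<longleftrightarrow> fst v = fst w"
| "incompatible (FacetVar F) (VertexVar v) \<longleftrightarrow> v \<notin> F"
| "incompatible (VertexVar v) (FacetVar F) \<longleftrightarrow> v \<notin> F"

definition quad :: "'x \<Rightarrow> 'x \<Rightarrow> ('x, 'k::field) mpoly" where
  "quad x y = Poly_Mapping.single (Poly_Mapping.single x 1 + Poly_Mapping.single y 1) 1"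

locale turan =
  fixes d :: nat and a :: "nat \<Rightarrow> nat"
  assumes d: "2 \<le> d" and a: "\<And>i. i \<in> {1..<d} \<Longrightarrow> 1 \<le> a i"
begin

abbreviation verts where "verts \<equiv> turan_vertices d a"
abbreviation facs where "facs \<equiv> turan_facets d a"
abbreviation faces where "faces \<equiv> turan_complex d a"
abbreviation vars where "vars \<equiv> cvars verts faces"
abbreviation dual_monos where "dual_monos \<equiv> (\<lambda>F. facet_mono F F) ` facs"

lemma vars_eq: "vars = FacetVar ` facs \<union> VertexVar ` verts"
  by (simp add: cvars_def facets_turan_complex)

lemma finite_vars: "finite vars"
  by (simp add: vars_eq)

lemma facet_finite: "F \<in> facs \<Longrightarrow> finite F"
  by (rule card_turan_facet(1))

lemma facet_verts: "F \<in> facs \<Longrightarrow> v \<in> F \<Longrightarrow> v \<in> verts"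
  by (auto simp: turan_facet_iff)

lemma facet_inj: "F \<in> facs \<Longrightarrow> v \<in> F \<Longrightarrow> w \<in> F \<Longrightarrow> fst v = fst w \<Longrightarrow> v = w"
  by (auto simp: turan_facet_iff bij_betw_def dest: inj_onD)

text \<open>The condition \<open>F - {v} = G - {w}\<close> forces \<open>v\<close> and
  \<open>w\<close> into the same class, so the binomials express the exchange of a single vertex of
  a facet.\<close>

definition quadrics :: "((nat \<times> nat) cvar, 'k::field) mpoly set" where
  "quadrics = {quad x y | x y. x \<in> vars \<and> y \<in> vars \<and> incompatible x y} \<union>
     {quad (FacetVar F) (VertexVar v) - quad (FacetVar G) (VertexVar w) | F G v w.
        F \<in> facs \<and> G \<in> facs \<and> v \<in> F \<and> w \<in> G \<and> F - {v} = G - {w}}"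

lemma quad_forms: "x \<in> vars \<Longrightarrow> y \<in> vars \<Longrightarrow> quad x y \<in> forms vars 2"
  unfolding quad_def using keys_add[of "Poly_Mapping.single x (1::nat)" "Poly_Mapping.single y 1"]
  by (intro forms_single) auto

lemma facet_var: "F \<in> facs \<Longrightarrow> FacetVar F \<in> vars"
  by (simp add: vars_eq)

lemma vertex_var: "F \<in> facs \<Longrightarrow> v \<in> F \<Longrightarrow> VertexVar v \<in> vars"
  using facet_verts[of F v] by (simp add: vars_eq)

lemma quadrics_forms: "quadrics \<subseteq> forms vars 2"
proof
  fix p :: "((nat \<times> nat) cvar, 'k::field) mpoly" assume "p \<in> quadrics"
  then show "p \<in> forms vars 2"
    unfolding quadrics_def
  proof (elim UnE CollectE exE conjE)
    fix x y assume "p = quad x y" "x \<in> vars" "y \<in> vars"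
    then show ?thesis by (simp add: quad_forms)
  next
    fix F G v w
    assume p: "p = quad (FacetVar F) (VertexVar v) - quad (FacetVar G) (VertexVar w)"
      and *: "F \<in> facs" "G \<in> facs" "v \<in> F" "w \<in> G"
    show ?thesis
      unfolding p by (intro forms_minus quad_forms facet_var vertex_var) (rule *)+
  qed
qed

lemma quadrics_carrier: "quadrics \<subseteq> carrier (poly_ring vars)"
  using quadrics_forms forms_carrier by blast

definition rel_ideal :: "((nat \<times> nat) cvar, 'k::field) mpoly set" where
  "rel_ideal = Idl\<^bsub>poly_ring vars\<^esub> quadrics"

lemma ideal_rel_ideal: "ideal rel_ideal (poly_ring vars)"
proof -
  interpret cring "poly_ring vars :: (_, 'k::field) mpoly ring" by (rule cring_poly_ring)
  show ?thesis unfolding rel_ideal_def by (rule genideal_ideal[OF quadrics_carrier])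
qed

lemma quadrics_rel_ideal: "quadrics \<subseteq> rel_ideal"
proof -
  interpret cring "poly_ring vars :: (_, 'k::field) mpoly ring" by (rule cring_poly_ring)
  show ?thesis unfolding rel_ideal_def by (rule genideal_self[OF quadrics_carrier])
qed

lemma quad_rel_ideal:
  assumes "x \<in> vars" "y \<in> vars" "incompatible x y"
  shows "quad x y \<in> rel_ideal"
proof -
  have "quad x y \<in> quadrics"
    unfolding quadrics_def by (intro UnI1 CollectI exI[of _ x] exI[of _ y]) (simp add: assms)
  then show ?thesis using quadrics_rel_ideal by blast
qed

lemma exchange_rel_ideal:
  assumes "F \<in> facs" "G \<in> facs" "v \<in> F" "w \<in> G" "F - {v} = G - {w}"
  shows "quad (FacetVar F) (VertexVar v) - quad (FacetVar G) (VertexVar w) \<in> rel_ideal"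
proof -
  have "quad (FacetVar F) (VertexVar v) - quad (FacetVar G) (VertexVar w) \<in> quadrics"
    unfolding quadrics_def
    by (intro UnI2 CollectI exI[of _ F] exI[of _ G] exI[of _ v] exI[of _ w]) (simp add: assms)
  then show ?thesis using quadrics_rel_ideal by blast
qed

lemmas rel_ideal = ideal_poly_ringD[OF ideal_rel_ideal]

lemma rel_ideal_trans: "p - q \<in> rel_ideal \<Longrightarrow> q - r \<in> rel_ideal \<Longrightarrow> p - r \<in> rel_ideal"
  using rel_ideal(3)[of "p - q" "q - r"] by simp

definition facet_over :: "(nat \<times> nat) set \<Rightarrow> (nat \<times> nat) set" where
  "facet_over T = (SOME F. F \<in> facs \<and> T \<subseteq> F)"

lemma facet_over: "T \<in> faces \<Longrightarrow> facet_over T \<in> facs \<and> T \<subseteq> facet_over T"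
  unfolding facet_over_def turan_complex_def by (rule someI_ex) auto

text \<open>
  The tag \<open>False\<close> marks the monomial \<open>U_S\<close>, the tag \<open>True\<close> the monomial \<open>X_F U_(F - T)\<close>, where the
  facet \<open>F\<close> containing \<open>T\<close> is irrelevant modulo the quadratic relations. With these tags the normal
  forms \<open>(False, S)\<close> and \<open>(True, S)\<close> are dual to each other.
\<close>

fun normal_form :: "bool \<times> (nat \<times> nat) set \<Rightarrow> (nat \<times> nat) cvar \<Rightarrow>\<^sub>0 nat" where
  "normal_form (False, S) = vertex_mono S"
| "normal_form (True, T) = facet_mono (facet_over T) (facet_over T - T)"

text \<open>A set \<open>D\<close> of degrees covers both uses: \<open>UNIV\<close> for the
  comparison with the annihilator, and \<open>{k}\<close> for the dimension of a single graded
  part.\<close>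

definition basis :: "nat set \<Rightarrow> (bool \<times> (nat \<times> nat) set) set" where
  "basis D = {b \<in> UNIV \<times> faces. mono_degree (normal_form b) \<in> D}"

lemma finite_basis: "finite (basis D)"
  by (simp add: basis_def)

lemma keys_vertex_mono: "S \<subseteq> verts \<Longrightarrow> Poly_Mapping.keys (vertex_mono S) \<subseteq> vars"
  unfolding vertex_mono_def by (rule order_trans[OF keys_sum]) (auto simp: vars_eq)

lemma keys_facet_mono:
  "F \<in> facs \<Longrightarrow> S \<subseteq> verts \<Longrightarrow> Poly_Mapping.keys (facet_mono F S) \<subseteq> vars"
  unfolding facet_mono_def using keys_vertex_mono[of S]
    keys_add[of "Poly_Mapping.single (FacetVar F) 1" "vertex_mono S"]
  by (auto simp: vars_eq)

lemma face_iff: "S \<in> faces \<longleftrightarrow> S \<subseteq> verts \<and> inj_on fst S"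
  by (rule turan_face_iff) (rule a)

lemma face_verts: "S \<in> faces \<Longrightarrow> S \<subseteq> verts"
  using face_iff by blast

lemma keys_normal_form: "b \<in> basis D \<Longrightarrow> Poly_Mapping.keys (normal_form b) \<subseteq> vars"
proof (cases b rule: normal_form.cases)
  case (1 S)
  assume "b \<in> basis D"
  with 1 show ?thesis by (auto simp: basis_def dest!: face_verts keys_vertex_mono)
next
  case (2 T)
  assume "b \<in> basis D"
  with 2 have "facet_over T \<in> facs" by (auto simp: basis_def facet_over)
  then have "Poly_Mapping.keys (normal_form b) \<subseteq> vars"
    unfolding 2 normal_form.simps by (intro keys_facet_mono) (auto intro: facet_verts)
  then show ?thesis .
qed

text \<open>There is one facet variable and there are \<open>d - 1 - card T\<close> vertex
  variables; the subtraction is exact because \<open>card T \<le> d - 1\<close>.\<close>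

lemma mono_degree_normal_form_True:
  assumes "T \<in> faces"
  shows "mono_degree (normal_form (True, T)) = d - card T"
proof -
  have "finite T" "T \<subseteq> facet_over T" "card (facet_over T) = d - 1"
    using facet_over[OF assms] card_turan_facet(2) turan_face_finite[OF assms] by auto
  moreover have "card T \<le> d - 1"
    by (rule turan_face_card_le[OF assms])
  ultimately show ?thesis
    using d by (simp add: card_Diff_subset)
qed

section \<open>Reduction to normal forms\<close>

lemma rel_ideal_single_mult:
  assumes "p \<in> rel_ideal" "Poly_Mapping.keys m \<subseteq> vars"
  shows "Poly_Mapping.single m c * p \<in> rel_ideal"
  using assms by (intro rel_ideal(4) poly_ring_single)

text \<open>A vertex of \<open>F\<close> outside \<open>G\<close> is traded for the vertex of
  \<open>G\<close> in the same class. This shrinks \<open>F - G\<close> and does not touch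
  \<open>T\<close>, which lies in both facets; once \<open>F\<close> is contained in
  \<open>G\<close>, the two coincide.\<close>

lemma facet_exchange:
  assumes "F \<in> facs" "G \<in> facs" "T \<subseteq> F" "T \<subseteq> G"
  shows "Poly_Mapping.single (facet_mono F (F - T)) c - Poly_Mapping.single (facet_mono G (G - T)) c
    \<in> rel_ideal"
  using assms
proof (induction "card (F - G)" arbitrary: F rule: less_induct)
  case less
  show ?case
  proof (cases "F \<subseteq> G")
    case True
    with less.prems have "F = G" by (intro turan_facet_eqI)
    then show ?thesis by (simp add: rel_ideal)
  next
    case False
    then obtain v where v: "v \<in> F" "v \<notin> G" by auto
    have "fst v \<in> fst ` G"
      using less.prems(1,2) v(1) by (auto simp: turan_facet_iff bij_betw_def)
    then obtain w where w: "w \<in> G" "fst w = fst v" by auto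
    have "w \<notin> F"
      using facet_inj[OF less.prems(1) v(1)] v(2) w by metis
    define F' where "F' = insert w (F - {v})"
    have F': "F' \<in> facs"
      unfolding F'_def using less.prems v w by (intro turan_facet_swap) (auto intro: facet_verts)
    have fin: "finite F" "finite F'"
      using less.prems(1) F' facet_finite by auto
    have T: "v \<notin> T" "w \<notin> T" "T \<subseteq> F'"
      using v \<open>w \<notin> F\<close> less.prems(3,4) by (auto simp: F'_def)
    \<comment> \<open>The common cofactor: both monomials are \<open>?n\<close> times one side of an
      exchange relation.\<close>
    let ?n = "vertex_mono (F - T - {v})"
    have 1: "facet_mono F (F - T) = ?n +
        (Poly_Mapping.single (FacetVar F) 1 + Poly_Mapping.single (VertexVar v) 1)"
      using fin v T vertex_mono_remove[of "F - T" v] by (simp add: facet_mono_def add_ac)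
    have "F' - T - {w} = F - T - {v}"
      using \<open>w \<notin> F\<close> T by (auto simp: F'_def)
    then have 2: "facet_mono F' (F' - T) = ?n +
        (Poly_Mapping.single (FacetVar F') 1 + Poly_Mapping.single (VertexVar w) 1)"
      using fin T vertex_mono_remove[of "F' - T" w] by (simp add: facet_mono_def add_ac F'_def)
    have "F - {v} = F' - {w}" "w \<in> F'"
      using \<open>w \<notin> F\<close> by (auto simp: F'_def)
    then have "quad (FacetVar F) (VertexVar v) - quad (FacetVar F') (VertexVar w) \<in> rel_ideal"
      using less.prems(1) F' v(1) by (intro exchange_rel_ideal)
    then have "Poly_Mapping.single ?n c *
        (quad (FacetVar F) (VertexVar v) - quad (FacetVar F') (VertexVar w)) \<in> rel_ideal"
      using less.prems(1) by (intro rel_ideal_single_mult keys_vertex_mono) (auto intro: facet_verts)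
    then have "Poly_Mapping.single (facet_mono F (F - T)) c -
        Poly_Mapping.single (facet_mono F' (F' - T)) c \<in> rel_ideal"
      unfolding 1 2 by (simp add: quad_def right_diff_distrib mult_single)
    moreover have "card (F' - G) < card (F - G)"
      using v w fin by (intro psubset_card_mono) (auto simp: F'_def)
    then have "Poly_Mapping.single (facet_mono F' (F' - T)) c -
        Poly_Mapping.single (facet_mono G (G - T)) c \<in> rel_ideal"
      using less.hyps F' less.prems T by blast
    ultimately show ?thesis
      by (rule rel_ideal_trans)
  qed
qed

text \<open>A monomial divisible by no incompatible pair is square-free with at most one facet
  variable; its vertices lie in different classes, and inside the facet if there is one.
  Divisibility is expressed by a truncated difference that is restored by addition.\<close>

lemma monomial_cases:
  assumes m: "Poly_Mapping.keys m \<subseteq> vars"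
  obtains x y where "x \<in> vars" "y \<in> vars" "incompatible x y"
      "m = m - (Poly_Mapping.single x 1 + Poly_Mapping.single y 1)
        + (Poly_Mapping.single x 1 + Poly_Mapping.single y 1)"
  | S where "S \<in> faces" "m = vertex_mono S"
  | F S where "F \<in> facs" "S \<subseteq> F" "m = facet_mono F S"
proof (cases "\<exists>x y. incompatible x y \<and> x \<in> Poly_Mapping.keys m \<and> y \<in> Poly_Mapping.keys m \<and>
    (x = y \<longrightarrow> 2 \<le> Poly_Mapping.lookup m x)")
  case True
  then obtain x y where xy: "incompatible x y" "x \<in> Poly_Mapping.keys m" "y \<in> Poly_Mapping.keys m"
    "x = y \<longrightarrow> 2 \<le> Poly_Mapping.lookup m x" by blast
  \<comment> \<open>Truncation does no harm because both variables occur in \<open>m\<close>, with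
    exponent at least \<open>2\<close> if they are equal.\<close>
  have "m = m - (Poly_Mapping.single x 1 + Poly_Mapping.single y 1)
        + (Poly_Mapping.single x 1 + Poly_Mapping.single y 1)"
    using xy(2-) by (intro poly_mapping_eqI)
      (auto simp: lookup_add lookup_minus lookup_single when_def in_keys_iff)
  with that(1) xy m show thesis by blast
next
  case False
  then have compat: "\<not> incompatible x y"
    if "x \<in> Poly_Mapping.keys m" "y \<in> Poly_Mapping.keys m" "x = y \<longrightarrow> 2 \<le> Poly_Mapping.lookup m x" for x y
    using that by blast
  have square_free: "Poly_Mapping.lookup m x = 1" if "x \<in> Poly_Mapping.keys m" for x
  proof -
    have "incompatible x x"
      by (cases x) auto
    with compat[OF that that] have "\<not> 2 \<le> Poly_Mapping.lookup m x"
      by blast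
    then show ?thesis
      using that unfolding in_keys_iff by linarith
  qed
  define S where "S = {v. VertexVar v \<in> Poly_Mapping.keys m}"
  have S: "S \<subseteq> verts"
    using m by (auto simp: S_def vars_eq)
  then have fin: "finite S"
    by (rule finite_subset) simp
  have look_S: "Poly_Mapping.lookup m (VertexVar v) = (if v \<in> S then 1 else 0)" for v
    using square_free by (auto simp: S_def in_keys_iff)
  show thesis
  proof (cases "\<exists>F. FacetVar F \<in> Poly_Mapping.keys m")
    case False
    have "v = w" if "v \<in> S" "w \<in> S" "fst v = fst w" for v w
      using compat[of "VertexVar v" "VertexVar w"] that by (auto simp: S_def)
    then have "S \<in> faces"
      using S face_iff by (auto simp: inj_on_def)
    moreover have "m = vertex_mono S"
    proof (rule poly_mapping_eqI)
      show "Poly_Mapping.lookup m x = Poly_Mapping.lookup (vertex_mono S) x" for x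
        using False by (cases x) (auto simp: look_S lookup_vertex_mono fin in_keys_iff)
    qed
    ultimately show thesis by (rule that(2))
  next
    case True
    then obtain F where F: "FacetVar F \<in> Poly_Mapping.keys m" by auto
    have unique: "G = F" if "FacetVar G \<in> Poly_Mapping.keys m" for G
      using compat[OF F that] by auto
    have "v \<in> F" if "v \<in> S" for v
      using compat[OF F, of "VertexVar v"] that by (auto simp: S_def)
    moreover have "m = facet_mono F S"
    proof (rule poly_mapping_eqI)
      show "Poly_Mapping.lookup m x = Poly_Mapping.lookup (facet_mono F S) x" for x
      proof (cases x)
        case (FacetVar G)
        then show ?thesis
          using F unique[of G] square_free[of x] by (auto simp: lookup_facet_mono fin in_keys_iff)
      qed (auto simp: look_S lookup_facet_mono fin)
    qed
    moreover have "F \<in> facs"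
      using F m by (auto simp: vars_eq)
    ultimately show thesis using that(3) by blast
  qed
qed

text \<open>The relations are homogeneous, so the normal form has the degree of \<open>m\<close>;
  this allows the reduction to be used separately in each degree.\<close>

lemma monomial_reduction:
  assumes m: "Poly_Mapping.keys m \<subseteq> vars"
  shows "Poly_Mapping.single m c \<in> rel_ideal \<or>
    (\<exists>b \<in> basis {mono_degree m}.
      Poly_Mapping.single m c - Poly_Mapping.single (normal_form b) c \<in> rel_ideal)"
  using m
proof (cases rule: monomial_cases)
  case (1 x y)
  let ?n = "m - (Poly_Mapping.single x 1 + Poly_Mapping.single y 1)"
  have "quad x y \<in> rel_ideal"
    using 1 by (intro quad_rel_ideal)
  moreover have "Poly_Mapping.keys ?n \<subseteq> vars"
    using m by (auto simp: in_keys_iff lookup_minus)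
  ultimately have "Poly_Mapping.single ?n c * quad x y \<in> rel_ideal"
    by (rule rel_ideal_single_mult)
  also have "Poly_Mapping.single ?n c * quad x y = Poly_Mapping.single m c"
    using 1(4) by (simp add: quad_def mult_single)
  finally show ?thesis ..
next
  case (2 S)
  then have "(False, S) \<in> basis {mono_degree m}"
    by (simp add: basis_def)
  moreover have "Poly_Mapping.single m c - Poly_Mapping.single (normal_form (False, S)) c \<in> rel_ideal"
    using 2 by (simp add: rel_ideal)
  ultimately show ?thesis by blast
next
  case (3 F S)
  \<comment> \<open>The complement of \<open>S\<close> in \<open>F\<close> labels the normal form:
    \<open>F - ?T\<close> is \<open>S\<close> again, and \<open>facet_exchange\<close> replaces
    \<open>F\<close> by the chosen facet over \<open>?T\<close>.\<close>
  let ?T = "F - S"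
  have T: "?T \<in> faces" "finite F"
    using 3 facet_finite by (auto simp: turan_complex_def)
  have "card ?T = card F - card S" "card S \<le> card F"
    using 3(2) T(2) finite_subset[OF 3(2) T(2)] by (simp_all add: card_Diff_subset card_mono)
  moreover have "card F = d - 1"
    by (rule card_turan_facet(2)[OF 3(1)])
  ultimately have "(True, ?T) \<in> basis {mono_degree m}"
    using T(1) 3(3) d by (simp add: basis_def mono_degree_normal_form_True del: normal_form.simps)
  moreover have "F - ?T = S" using 3 by auto
  then have "Poly_Mapping.single m c - Poly_Mapping.single (normal_form (True, ?T)) c \<in> rel_ideal"
    using facet_exchange[of F "facet_over ?T" ?T c] facet_over[OF T(1)] 3 by auto
  ultimately show ?thesis by blast
qed

text \<open>Terms are reduced one by one and the coefficients added; a term in the ideal contributes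
  the zero family.\<close>

lemma normal_form_reduction:
  assumes "Poly_Mapping.keys p \<subseteq> {m. Poly_Mapping.keys m \<subseteq> vars \<and> mono_degree m \<in> D}"
  shows "\<exists>c. p - (\<Sum>b\<in>basis D. Poly_Mapping.single (normal_form b) (c b)) \<in> rel_ideal"
  using assms
proof (induction p rule: poly_mapping_single_induct)
  case zero
  show ?case
    by (rule exI[of _ "\<lambda>_. 0"]) (simp add: rel_ideal)
next
  case (single m c)
  then consider "Poly_Mapping.single m c \<in> rel_ideal"
    | b where "b \<in> basis {mono_degree m}"
      "Poly_Mapping.single m c - Poly_Mapping.single (normal_form b) c \<in> rel_ideal"
    using monomial_reduction[of m c] by blast
  then show ?case
  proof cases
    case 1
    then show ?thesis by (intro exI[of _ "\<lambda>_. 0"]) simp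
  next
    case (2 b)
    have "(\<Sum>b'\<in>basis D. Poly_Mapping.single (normal_form b') (if b' = b then c else 0)) =
        (\<Sum>b'\<in>basis D. if b' = b then Poly_Mapping.single (normal_form b) c else 0)"
      by (intro sum.cong) auto
    also have "\<dots> = Poly_Mapping.single (normal_form b) c"
      using 2(1) single by (auto simp: basis_def finite_basis[unfolded basis_def])
    finally show ?thesis
      using 2(2) by (intro exI[of _ "\<lambda>b'. if b' = b then c else 0"]) simp
  qed
next
  case (add p q)
  then obtain c c' where
    "p - (\<Sum>b\<in>basis D. Poly_Mapping.single (normal_form b) (c b)) \<in> rel_ideal"
    "q - (\<Sum>b\<in>basis D. Poly_Mapping.single (normal_form b) (c' b)) \<in> rel_ideal" by auto
  from rel_ideal(3)[OF this] show ?case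
    by (intro exI[of _ "\<lambda>b. c b + c' b"]) (simp add: single_add sum.distrib algebra_simps)
qed

section \<open>The quadratic relations generate the annihilator\<close>

definition ann :: "((nat \<times> nat) cvar, 'k::field_char_0) mpoly set" where
  "ann = Ann vars (complex_form faces)"

text \<open>The pairing of the form itself, whose divided coefficients are the indicator of
  \<open>dual_monos\<close>. On a monomial it tests whether the product with \<open>n\<close> is a
  term of the form.\<close>

definition pair :: "((nat \<times> nat) cvar \<Rightarrow>\<^sub>0 nat) \<Rightarrow>
    ((nat \<times> nat) cvar, 'k::field_char_0) mpoly \<Rightarrow> 'k" where
  "pair = pairing (\<lambda>n. if n \<in> dual_monos then 1 else 0)"

lemma divided_coeff_turan:
  "divided_coeff (complex_form faces) n = (if n \<in> dual_monos then 1 else 0)"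
  using divided_coeff_complex_form[of faces n] facet_finite
  by (simp add: facets_turan_complex)

lemma ann_eq:
  "ann = {p \<in> carrier (poly_ring vars). \<forall>n. pair n (p :: (_, 'k::field_char_0) mpoly) = 0}"
proof -
  have "divided_coeff (complex_form faces) = (\<lambda>n. if n \<in> dual_monos then 1 else 0 :: 'k)"
    by (rule ext) (rule divided_coeff_turan)
  then show ?thesis by (simp add: ann_def pair_def Ann_eq)
qed

lemma ideal_ann: "ideal ann (poly_ring vars)"
  unfolding ann_def by (rule ideal_Ann)

section \<open>Annihilation of the form by the quadratic relations\<close>

lemma dual_mono_lookup:
  assumes "n \<in> dual_monos"
  shows "\<exists>F \<in> facs. (\<forall>v. Poly_Mapping.lookup n (VertexVar v) = (if v \<in> F then 1 else 0)) \<and>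
    (\<forall>G. Poly_Mapping.lookup n (FacetVar G) = (if F = G then 1 else 0))"
proof -
  obtain F where F: "F \<in> facs" "n = facet_mono F F"
    using assms by blast
  then show ?thesis
    using facet_finite[OF F(1)] by (intro bexI[of _ F]) (simp_all add: lookup_facet_mono)
qed

text \<open>A dual monomial is square-free and consists of one facet variable and the vertices of
  that facet, so any two variables in it are compatible.\<close>

lemma incompatible_not_dual:
  assumes "incompatible x y"
  shows "n + (Poly_Mapping.single x 1 + Poly_Mapping.single y 1) \<notin> dual_monos" (is "?m \<notin> _")
proof
  assume "?m \<in> dual_monos"
  then obtain F where F: "F \<in> facs"
    "\<And>v. Poly_Mapping.lookup ?m (VertexVar v) = (if v \<in> F then 1 else 0)"
    "\<And>G. Poly_Mapping.lookup ?m (FacetVar G) = (if F = G then 1 else 0)"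
    using dual_mono_lookup by blast
  have bound: "Poly_Mapping.lookup ?m z \<le> 1" for z
    by (cases z) (simp_all only: F, simp_all)
  have pos: "0 < Poly_Mapping.lookup ?m x" "0 < Poly_Mapping.lookup ?m y"
    by (simp_all add: lookup_add)
  have vertex: "v \<in> F" if "0 < Poly_Mapping.lookup ?m (VertexVar v)" for v
    using that unfolding F by (simp split: if_splits)
  have facet: "G = F" if "0 < Poly_Mapping.lookup ?m (FacetVar G)" for G
    using that unfolding F by (simp split: if_splits)
  have "x \<noteq> y"
    using bound[of x] by (auto simp: lookup_add)
  show False
  proof (cases x)
    case x: (FacetVar G)
    show ?thesis
    proof (cases y)
      case (FacetVar H)
      then show ?thesis
        using facet[of G] facet[of H] pos x \<open>x \<noteq> y\<close> by simp
    next
      case (VertexVar w)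
      then show ?thesis
        using facet[of G] vertex[of w] pos x assms by simp
    qed
  next
    case x: (VertexVar v)
    show ?thesis
    proof (cases y)
      case (FacetVar H)
      then show ?thesis
        using facet[of H] vertex[of v] pos x assms by simp
    next
      case (VertexVar w)
      then show ?thesis
        using vertex[of v] vertex[of w] facet_inj[OF F(1), of v w] pos x assms \<open>x \<noteq> y\<close> by simp
    qed
  qed
qed

text \<open>The facet variable determines the term of the form, hence \<open>n\<close> is the
  monomial of \<open>F - {v}\<close>. As this set equals \<open>G - {w}\<close>, multiplying by the
  other pair produces the term of \<open>G\<close>.\<close>

lemma exchange_dual:
  assumes "F \<in> facs" "G \<in> facs" "v \<in> F" "w \<in> G" "F - {v} = G - {w}"
    and "n + (Poly_Mapping.single (FacetVar F) 1 + Poly_Mapping.single (VertexVar v) 1) \<in> dual_monos" (is "?m \<in> _")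
  shows "n + (Poly_Mapping.single (FacetVar G) 1 + Poly_Mapping.single (VertexVar w) 1) \<in> dual_monos"
proof -
  obtain H where H: "H \<in> facs" "?m = facet_mono H H"
    using assms(6) by blast
  have "H = F"
    using lookup_facet_mono(2)[OF facet_finite[OF H(1)], of H F]
    by (simp flip: H(2) add: lookup_add split: if_splits)
  have "facet_mono F F = vertex_mono (F - {v}) +
      (Poly_Mapping.single (FacetVar F) 1 + Poly_Mapping.single (VertexVar v) 1)"
    using vertex_mono_remove[OF facet_finite[OF assms(1)] assms(3)]
    by (simp add: facet_mono_def add_ac)
  with H(2) \<open>H = F\<close> have "n = vertex_mono (F - {v})"
    by (simp only: add_right_cancel)
  then have "n + (Poly_Mapping.single (FacetVar G) 1 + Poly_Mapping.single (VertexVar w) 1) =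
      facet_mono G G"
    using vertex_mono_remove[OF facet_finite[OF assms(2)] assms(4)] assms(5)
    by (simp add: facet_mono_def add_ac)
  then show ?thesis using assms(2) by blast
qed

lemma pair_quad:
  "pair n (quad x y) =
    (if n + (Poly_Mapping.single x 1 + Poly_Mapping.single y 1) \<in> dual_monos then 1 else 0)"
  by (simp add: pair_def quad_def)

lemma pair_minus: "pair n (p - q) = pair n p - pair n q"
  using pairing_add[of _ n "p - q" q] by (simp add: pair_def del: pairing_add)

text \<open>The annihilator is an ideal, so the generators suffice: incompatible pairs give
  \<open>0\<close>, and the two terms of an exchange relation pair equally by
  \<open>exchange_dual\<close> in both directions.\<close>

lemma rel_ideal_subset_ann:
  "rel_ideal \<subseteq> (ann :: ((nat \<times> nat) cvar, 'k::field_char_0) mpoly set)"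
proof -
  interpret cring "poly_ring vars :: ((nat \<times> nat) cvar, 'k) mpoly ring" by (rule cring_poly_ring)
  have "pair n p = 0" if "p \<in> quadrics" for n and p :: "((nat \<times> nat) cvar, 'k) mpoly"
    using that unfolding quadrics_def
  proof (elim UnE CollectE exE conjE)
    fix F G v w
    assume *: "p = quad (FacetVar F) (VertexVar v) - quad (FacetVar G) (VertexVar w)"
      "F \<in> facs" "G \<in> facs" "v \<in> F" "w \<in> G" "F - {v} = G - {w}"
    show ?thesis
      using exchange_dual[OF *(2-6)] exchange_dual[OF *(3,2,5,4) *(6)[symmetric]]
      unfolding *(1) pair_minus pair_quad by simp
  qed (simp only: pair_quad incompatible_not_dual if_False)
  then have "quadrics \<subseteq> (ann :: ((nat \<times> nat) cvar, 'k) mpoly set)"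
    using quadrics_carrier by (auto simp: ann_eq)
  then show ?thesis
    unfolding rel_ideal_def by (intro genideal_minimal ideal_ann)
qed

section \<open>Duality and independence of the normal forms\<close>

text \<open>A dual monomial has exactly one facet variable, so the two normal forms multiplied must
  carry opposite tags, that is \<open>\<beta> = \<beta>'\<close>. Then the set of the vertex
  monomial must be the complement of \<open>facet_over T - T\<close> in \<open>facet_over T\<close>,
  up to the roles of \<open>S\<close> and \<open>T\<close>, and this complement is
  \<open>T\<close>.\<close>

lemma normal_form_dual:
  assumes "S \<in> faces" "T \<in> faces"
  shows "normal_form (\<not> \<beta>, S) + normal_form (\<beta>', T) \<in> dual_monos \<longleftrightarrow> \<beta> = \<beta>' \<and> S = T"
proof -
  have fin: "finite S" "finite T"
    using assms turan_face_finite by auto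
  have fac: "finite (facet_over S)" "finite (facet_over T)" "S \<subseteq> facet_over S" "T \<subseteq> facet_over T"
      "facet_over S \<in> facs" "facet_over T \<in> facs"
    using facet_over assms facet_finite by auto
  have mixed: "vertex_mono S + normal_form (True, T) \<in> dual_monos \<longleftrightarrow> S = T"
    if "S \<in> faces" "T \<in> faces" for S T
  proof -
    have *: "finite S" "finite (facet_over T - T)" "T \<subseteq> facet_over T" "facet_over T \<in> facs"
      using facet_over that facet_finite turan_face_finite by auto
    have "vertex_mono S + normal_form (True, T) \<in> dual_monos \<longleftrightarrow>
        (\<exists>G\<in>facs. facet_over T = G \<and> S \<inter> (facet_over T - T) = {} \<and> S \<union> (facet_over T - T) = G)"
      using vertex_facet_mono_eq_iff[OF *(1,2)] facet_finite by (auto simp: image_iff)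
    also have "\<dots> \<longleftrightarrow> S = T"
      using *(3,4) by blast
    finally show ?thesis .
  qed
  show ?thesis
  proof (cases "\<beta> = \<beta>'")
    case True
    then show ?thesis
      using mixed[OF assms] mixed[OF assms(2,1)]
      by (cases \<beta>') (auto simp: add.commute simp del: normal_form.simps(2))
  next
    case False
    have "normal_form (\<beta>', S) + normal_form (\<beta>', T) \<notin> dual_monos"
    proof
      assume "normal_form (\<beta>', S) + normal_form (\<beta>', T) \<in> dual_monos"
      then obtain F where F: "\<And>G. Poly_Mapping.lookup (normal_form (\<beta>', S) + normal_form (\<beta>', T)) (FacetVar G)
          = (if F = G then 1 else 0)"
        using dual_mono_lookup by blast
      \<comment> \<open>Without facet variables the exponent at \<open>F\<close> is
        \<open>0\<close>; with two of them, either an exponent is \<open>2\<close> or two different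
        facets occur.\<close>
      show False
        using F[of F] F[of "facet_over S"] F[of "facet_over T"] fin fac(1,2)
        by (cases \<beta>') (simp_all add: lookup_add lookup_vertex_mono lookup_facet_mono split: if_splits)
    qed
    with False show ?thesis by (cases \<beta>; cases \<beta>') auto
  qed
qed

text \<open>Pairing with the dual normal form, obtained by negating the tag, isolates one
  coefficient.\<close>

lemma normal_form_independent:
  assumes "(\<Sum>b\<in>basis D. Poly_Mapping.single (normal_form b) (c b)) \<in> ann" "b \<in> basis D"
  shows "c b = 0"
proof -
  obtain \<beta> S where b: "b = (\<beta>, S)" "S \<in> faces"
    using assms(2) by (auto simp: basis_def)
  have "0 = pair (normal_form (\<not> \<beta>, S)) (\<Sum>b\<in>basis D. Poly_Mapping.single (normal_form b) (c b))"
    using assms(1) by (simp add: ann_eq)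
  also have "\<dots> = (\<Sum>b'\<in>basis D. if b' = b then c b else 0)"
    unfolding pair_def pairing_sum pairing_single
  proof (rule sum.cong[OF refl])
    fix b' assume "b' \<in> basis D"
    then obtain \<beta>' T where b': "b' = (\<beta>', T)" "T \<in> faces"
      by (auto simp: basis_def)
    then show "c b' * (if normal_form (\<not> \<beta>, S) + normal_form b' \<in> dual_monos then 1 else 0) =
        (if b' = b then c b else 0)"
      using normal_form_dual[OF b(2) b'(2), of \<beta> \<beta>'] b(1)
      by (auto simp del: normal_form.simps)
  qed
  also have "\<dots> = c b"
    using assms(2) finite_basis by simp
  finally show ?thesis by simp
qed

text \<open>Reducing an element of the annihilator leaves a combination of normal forms that again
  lies in the annihilator; by independence it is zero.\<close>

lemma ann_eq_rel_ideal:
  "ann = (rel_ideal :: ((nat \<times> nat) cvar, 'k::field_char_0) mpoly set)"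
proof
  show "ann \<subseteq> (rel_ideal :: ((nat \<times> nat) cvar, 'k) mpoly set)"
  proof
    fix p :: "((nat \<times> nat) cvar, 'k) mpoly" assume p: "p \<in> ann"
    then have "Poly_Mapping.keys p \<subseteq> {m. Poly_Mapping.keys m \<subseteq> vars \<and> mono_degree m \<in> UNIV}"
      by (auto simp: ann_eq carrier_poly_ring)
    then obtain c where c: "p - (\<Sum>b\<in>basis UNIV. Poly_Mapping.single (normal_form b) (c b)) \<in> rel_ideal"
      (is "p - ?s \<in> _")
      using normal_form_reduction by blast
    with p ideal_poly_ringD(5)[OF ideal_ann p, of "p - ?s"] rel_ideal_subset_ann
    have "?s \<in> ann" by auto
    then have "?s = 0"
      using normal_form_independent[of c UNIV] by (intro sum.neutral) auto
    with c show "p \<in> rel_ideal" by simp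
  qed
qed (rule rel_ideal_subset_ann)

section \<open>Quadratic presentation and Hilbert vector\<close>

lemma turan_algebra_eq:
  "(turan_algebra d a :: 'k::field_char_0 turan_algebra) = quotient_algebra vars rel_ideal"
  unfolding turan_algebra_def associated_algebra_def ann_def[symmetric] ann_eq_rel_ideal ..

lemma presented: "presented_by_quadrics (turan_algebra d a :: 'k::field_char_0 turan_algebra)"
  unfolding turan_algebra_eq rel_ideal_def
  by (rule presented_by_quadricsI[OF finite_vars quadrics_forms])

lemma card_faces: "card {S \<in> faces. card S = k} = elem_sym d a k"
  by (rule card_turan_faces) (rule a)

text \<open>The normal form with tag \<open>True\<close> of a face \<open>T\<close> has degree
  \<open>d - card T\<close>. Since \<open>k \<le> d\<close> and \<open>card T < d\<close>, this is
  \<open>k\<close> exactly if \<open>card T = d - k\<close>.\<close>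

lemma card_basis:
  assumes "k \<le> d"
  shows "card (basis {k}) = elem_sym d a k + elem_sym d a (d - k)"
proof -
  have "basis {k} = {False} \<times> {S \<in> faces. card S = k} \<union> {True} \<times> {S \<in> faces. card S = d - k}"
  proof (rule Set.set_eqI)
    fix b :: "bool \<times> (nat \<times> nat) set"
    obtain \<beta> S where b: "b = (\<beta>, S)" by force
    have "card S \<le> d - 1" if "S \<in> faces"
      using that by (rule turan_face_card_le)
    then show "b \<in> basis {k} \<longleftrightarrow>
        b \<in> {False} \<times> {S \<in> faces. card S = k} \<union> {True} \<times> {S \<in> faces. card S = d - k}"
      using assms d unfolding b
      by (cases \<beta>) (auto simp: basis_def mono_degree_normal_form_True simp del: normal_form.simps(2))
  qed
  moreover have "card ({False} \<times> {S \<in> faces. card S = k} \<union> {True} \<times> {S \<in> faces. card S = d - k}) =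
      card {S \<in> faces. card S = k} + card {S \<in> faces. card S = d - k}"
    by (subst card_Un_disjoint) (auto simp: card_cartesian_product)
  ultimately show ?thesis
    by (simp add: card_faces)
qed

lemma basis_empty:
  assumes "d < k"
  shows "basis {k} = {}"
proof -
  have degree: "mono_degree (normal_form (\<beta>, S)) \<le> d" if "S \<in> faces" for \<beta> S
    using turan_face_card_le[OF that] mono_degree_normal_form_True[OF that]
    by (cases \<beta>) (auto simp del: normal_form.simps(2))
  have "b \<notin> basis {k}" for b
  proof
    assume "b \<in> basis {k}"
    then have "snd b \<in> faces" "mono_degree (normal_form (fst b, snd b)) = k"
      by (simp_all add: basis_def mem_Times_iff)
    with degree[of "snd b" "fst b"] assms show False by simp
  qed
  then show ?thesis by blast
qed

text \<open>In each degree the classes of the normal forms span by reduction and are independent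
  modulo the annihilator, so \<open>card_basis\<close> gives the dimension. Beyond degree
  \<open>d\<close> only the class of the empty sum remains.\<close>

lemma hilbert:
  "hilbert_vector (turan_algebra d a :: 'k::field_char_0 turan_algebra)
    (map (\<lambda>k. elem_sym d a k + elem_sym d a (d - k)) [0..<Suc d])"
proof -
  interpret poly_quotient vars "rel_ideal :: ((nat \<times> nat) cvar, 'k) mpoly set"
    by (rule poly_quotient.intro[OF ideal_rel_ideal])
  let ?g = "\<lambda>b. Poly_Mapping.single (normal_form b) (1 :: 'k)"
  have const: "mp_const c * ?g b = Poly_Mapping.single (normal_form b) c" for c b
    by (simp add: mp_const_def mult_single)
  have single: "Poly_Mapping.single (normal_form b) (c :: 'k) \<in> forms vars k" if "b \<in> basis {k}" for b c k
    using that keys_normal_form[OF that] by (intro forms_single) (auto simp: basis_def)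
  have grade: "grade Q k = {cls (\<Sum>b\<in>basis {k}. mp_const (c b) * ?g b) | c. True}" for k
    unfolding Q_sel(4) const
  proof (intro equalityI subsetI)
    fix x assume "x \<in> cls ` forms vars k"
    then obtain p where p: "x = cls p" "p \<in> forms vars k" by auto
    then obtain c where "p - (\<Sum>b\<in>basis {k}. Poly_Mapping.single (normal_form b) (c b)) \<in> rel_ideal"
      using normal_form_reduction[of p "{k}"] by (auto simp: forms_eq)
    moreover have "(\<Sum>b\<in>basis {k}. Poly_Mapping.single (normal_form b) (c b)) \<in> carrier (poly_ring vars)"
      by (intro poly_ring_sum forms_carrier[OF single])
    ultimately have "x = cls (\<Sum>b\<in>basis {k}. Poly_Mapping.single (normal_form b) (c b))"
      unfolding p(1) using forms_carrier[OF p(2)] by (simp add: cls_eq_iff)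
    then show "x \<in> {cls (\<Sum>b\<in>basis {k}. Poly_Mapping.single (normal_form b) (c b)) | c. True}"
      by blast
  qed (auto intro!: imageI forms_sum single)
  have "ring.dimension Q (card (basis {k})) (base_field Q) (grade Q k)" for k
    unfolding grade
  proof (rule dimension_Q)
    show "c b = 0" if "(\<Sum>b\<in>basis {k}. mp_const (c b) * ?g b) \<in> rel_ideal" "b \<in> basis {k}" for c b
      using that normal_form_independent[of c "{k}" b] rel_ideal_subset_ann unfolding const by blast
  qed (auto intro: finite_basis forms_carrier single)
  moreover have "grade Q k = {\<zero>\<^bsub>Q\<^esub>}" if "d < k" for k
    unfolding grade basis_empty[OF that] by (simp add: Q_sel)
  ultimately show ?thesis
    unfolding turan_algebra_eq hilbert_vector_def
    by (auto simp: card_basis[symmetric] nth_map simp del: upt_Suc)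
qed

end

theorem theorem3p7:
  fixes d :: nat and a :: "nat \<Rightarrow> nat"
  assumes "2 \<le> d"
    and "\<And>i. i \<in> {1..<d} \<Longrightarrow> 2 \<le> a i"
    and "mono_on {1..<d} a"
  shows "presented_by_quadrics (turan_algebra d a :: 'k::field_char_0 turan_algebra) \<and>
    hilbert_vector (turan_algebra d a :: 'k turan_algebra)
      (map (\<lambda>k. elem_sym d a k + elem_sym d a (d - k)) [0..<Suc d])"
proof -
  interpret turan d a
    using assms(1,2) by unfold_locales force+
  show ?thesis using presented hilbert by blast
qed

end
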